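(* Let $n\ge 1$ and $\ell\ge 3$ be integers and let $S(n,\ell)$ be the Sierpiński graph. (i) For every integer $k$ with $3\le k\le \ell$, $$\kappa_k(S(n,\ell))=\lambda_k(S(n,\ell))=\ell-\lceil k/2\rceil .$$ (ii) For every integer $k$ with $\ell+1\le k\le \ell^n$, $$\kappa_k(S(n,\ell))\le \lfloor \ell/2\rfloor \quad\text{and}\quad \lambda_k(S(n,\ell))=\lfloor \ell/2\rfloor .$$
   Context: All graphs are finite, simple and undirected. Sierpiński graph: for $n\ge1$, $\ell\ge3$, the graph $S(n,\ell)$ has as vertex set all $n$-tuples $\langle u_0u_1\cdots u_{n-1}\rangle$ with $u_i\in\{0,1,\ldots,\ell-1\}$. Two vertices $u=\langle u_0\cdots u_{n-1}\rangle$ and $v=\langle v_0\cdots v_{n-1}\rangle$ are adjacent if and only if there exists $d\in\{0,1,\ldots,n-1\}$ such that (1) $u_j=v_j$ for all $j<d$; (2) $u_d\ne v_d$; (3) $u_j=v_d$ and $v_j=u_d$ for all $j>d$. Steiner trees: for a graph $G$ and $S\subseteq V(G)$ with $|S|\ge2$, an $S$-Steiner tree is a subgraph $T$ of $G$ that is a tree with $S\subseteq V(T)$. $S$-Steiner trees $T_1,\ldots,T_p$ are edge-disjoint if $E(T_i)\cap E(T_j)=\emptyset$ for all $i\ne j$; they are internally disjoint if $E(T_i)\cap E(T_j)=\emptyset$ and $V(T_i)\cap V(T_j)=S$ for all $i\neq j$. Let $\kappa_G(S)$ (respectively $\lambda_G(S)$) be the maximum number of internally disjoint (respectively edge-disjoint)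 $S$-Steiner trees in $G$. The generalized $k$-connectivity is $\kappa_k(G)=\min\{\kappa_G(S): S\subseteq V(G), |S|=k\}$, and the generalized $k$-edge-connectivity is $\lambda_k(G)=\min\{\lambda_G(S): S\subseteq V(G), |S|=k\}$. *)

theory Defs
  imports Complex_Main "Graph_Theory.Graph_Theory"
begin

text \<open>
  Undirected graphs are the symmetric, loop-free, finite digraphs of
  \<^locale>\<open>pair_graph\<close>: an edge \<open>{u, v}\<close> is the pair of arcs \<open>(u, v)\<close> and \<open>(v, u)\<close>.
  Hence two such graphs are edge-disjoint iff their arc sets are disjoint.
\<close>

definition sierpinski :: "nat \<Rightarrow> nat \<Rightarrow> nat list pair_pre_digraph" where
  "sierpinski n l =
    (let V = {u. length u = n \<and> set u \<subseteq> {..<l}} in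
     \<lparr> pverts = V,
       parcs = {(u, v). u \<in> V \<and> v \<in> V \<and>
         (\<exists>d<n. (\<forall>j<d. u ! j = v ! j) \<and> u ! d \<noteq> v ! d \<and>
                (\<forall>j. d < j \<and> j < n \<longrightarrow> u ! j = v ! d \<and> v ! j = u ! d))} \<rparr>)"

text \<open>
  The library's \<^const>\<open>tree\<close> forbids only directed cycles. It is not the undirected notion:
  a transitively oriented triangle satisfies it, while the symmetric digraph of a single edge
  does not (the walk \<open>u, v, u\<close> is a directed cycle). In a symmetric loop-free digraph
  without parallel arcs, the undirected cycles are the directed cycles of length at least 3.
\<close>

definition undirected_tree :: "'a pair_pre_digraph \<Rightarrow> bool" where
  "undirected_tree T \<longleftrightarrow> pair_graph T \<and> connected T \<and>
     \<not> (\<exists>p. pre_digraph.cycle T p \<and> 3 \<le> length p)"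

definition steiner_tree :: "'a pair_pre_digraph \<Rightarrow> 'a set \<Rightarrow> 'a pair_pre_digraph \<Rightarrow> bool" where
  "steiner_tree G S T \<longleftrightarrow> undirected_tree T \<and> subgraph T G \<and> S \<subseteq> pverts T"

definition edge_disjoint_steiner ::
    "'a pair_pre_digraph \<Rightarrow> 'a set \<Rightarrow> nat \<Rightarrow> (nat \<Rightarrow> 'a pair_pre_digraph) \<Rightarrow> bool" where
  "edge_disjoint_steiner G S p T \<longleftrightarrow>
     (\<forall>i<p. steiner_tree G S (T i)) \<and>
     (\<forall>i<p. \<forall>j<p. i \<noteq> j \<longrightarrow> parcs (T i) \<inter> parcs (T j) = {})"

definition internally_disjoint_steiner ::
    "'a pair_pre_digraph \<Rightarrow> 'a set \<Rightarrow> nat \<Rightarrow> (nat \<Rightarrow> 'a pair_pre_digraph) \<Rightarrow> bool" where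
  "internally_disjoint_steiner G S p T \<longleftrightarrow>
     (\<forall>i<p. steiner_tree G S (T i)) \<and>
     (\<forall>i<p. \<forall>j<p. i \<noteq> j \<longrightarrow>
        parcs (T i) \<inter> parcs (T j) = {} \<and> pverts (T i) \<inter> pverts (T j) = S)"

text \<open>
  The two maxima below are over finite sets, and hence meaningful, whenever \<open>G\<close> is finite and
  \<open>card S \<ge> 2\<close>; see \<open>finite_edge_disjoint_steiner\<close>. The minima are meaningful whenever
  moreover \<open>k \<le> card (pverts G)\<close>.
\<close>

definition kappa_set :: "'a pair_pre_digraph \<Rightarrow> 'a set \<Rightarrow> nat" where
  "kappa_set G S = Max {p. \<exists>T. internally_disjoint_steiner G S p T}"

definition lambda_set :: "'a pair_pre_digraph \<Rightarrow> 'a set \<Rightarrow> nat" where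
  "lambda_set G S = Max {p. \<exists>T. edge_disjoint_steiner G S p T}"

definition gen_connectivity :: "nat \<Rightarrow> 'a pair_pre_digraph \<Rightarrow> nat" where
  "gen_connectivity k G = Min {kappa_set G S | S. S \<subseteq> pverts G \<and> card S = k}"

definition gen_edge_connectivity :: "nat \<Rightarrow> 'a pair_pre_digraph \<Rightarrow> nat" where
  "gen_edge_connectivity k G = Min {lambda_set G S | S. S \<subseteq> pverts G \<and> card S = k}"


lemma pverts_sierpinski: "pverts (sierpinski n l) = {u. set u \<subseteq> {..<l} \<and> length u = n}"
  by (auto simp: sierpinski_def Let_def)

lemma card_pverts_sierpinski: "card (pverts (sierpinski n l)) = l ^ n"
  unfolding pverts_sierpinski using card_lists_length_eq[of "{..<l}" n] by simp

lemma in_parcs_sierpinski: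
  "(u, v) \<in> parcs (sierpinski n l) \<longleftrightarrow>
     u \<in> pverts (sierpinski n l) \<and> v \<in> pverts (sierpinski n l) \<and>
     (\<exists>d<n. (\<forall>j<d. u ! j = v ! j) \<and> u ! d \<noteq> v ! d \<and>
            (\<forall>j. d < j \<and> j < n \<longrightarrow> u ! j = v ! d \<and> v ! j = u ! d))"
  by (simp only: sierpinski_def Let_def pair_pre_digraph.simps mem_Collect_eq case_prod_conv)

lemma pair_graph_sierpinski: "pair_graph (sierpinski n l)"
proof -
  have fin: "finite (pverts (sierpinski n l))"
    unfolding pverts_sierpinski using finite_lists_length_eq[of "{..<l}" n] by simp
  have mem: "u \<in> pverts (sierpinski n l)" "v \<in> pverts (sierpinski n l)"
    if "(u, v) \<in> parcs (sierpinski n l)" for u v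
    using that unfolding in_parcs_sierpinski by blast+
  have loop: "u \<noteq> v" if "(u, v) \<in> parcs (sierpinski n l)" for u v
    using that unfolding in_parcs_sierpinski by blast
  have sym: "(v, u) \<in> parcs (sierpinski n l)" if uv: "(u, v) \<in> parcs (sierpinski n l)" for u v
  proof -
    obtain d where d: "d < n" "\<forall>j<d. u ! j = v ! j" "u ! d \<noteq> v ! d"
        "\<forall>j. d < j \<and> j < n \<longrightarrow> u ! j = v ! d \<and> v ! j = u ! d"
      using uv unfolding in_parcs_sierpinski by (elim conjE exE)
    have "\<forall>j<d. v ! j = u ! j"
      using d(2) by simp
    moreover have "v ! d \<noteq> u ! d"
      using d(3) by (rule not_sym)
    moreover have "\<forall>j. d < j \<and> j < n \<longrightarrow> v ! j = u ! d \<and> u ! j = v ! d"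
      using d(4) by blast
    ultimately show ?thesis
      unfolding in_parcs_sierpinski by (intro conjI exI[of _ d] mem[OF uv] d(1))
  qed
  have "finite (parcs (sierpinski n l))"
    by (rule finite_subset[OF _ finite_cartesian_product[OF fin fin]]) (use mem in auto)
  moreover have "symmetric (sierpinski n l)"
    using sym by (simp add: symmetric_def sym_def)
  ultimately show ?thesis
    using fin mem loop by unfold_locales force+
qed

lemma steiner_tree_arcs_nonempty:
  assumes "steiner_tree G S T" "2 \<le> card S"
  shows "parcs T \<noteq> {}"
proof
  assume none: "parcs T = {}"
  have "finite S" using assms(2) by (metis card.infinite not_numeral_le_zero)
  moreover have "\<not> card S \<le> Suc 0" using assms(2) by simp
  ultimately obtain u v where uv: "u \<in> S" "v \<in> S" "u \<noteq> v"
    by (metis card_le_Suc0_iff_eq)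
  have "u \<rightarrow>\<^sup>*\<^bsub>with_proj (mk_symmetric T)\<^esub> v"
    using assms(1) uv(1,2)
    unfolding steiner_tree_def undirected_tree_def connected_def strongly_connected_def
    by (auto simp: mk_symmetric_def)
  then have "(u, v) \<in> rtrancl_on (pverts T) {}"
    by (simp add: reachable_def mk_symmetric_def none)
  then show False using uv(3) by (induct rule: rtrancl_on_induct) auto
qed

lemma finite_edge_disjoint_steiner:
  assumes "pair_graph G" "2 \<le> card S"
  shows "finite {p. \<exists>T. edge_disjoint_steiner G S p T}"
proof -
  have fin: "finite (parcs G)"
    using assms(1) by (simp add: pair_graph_def pair_digraph_def pair_fin_digraph.pair_finite_arcs)
  have "p \<le> card (parcs G)" if "edge_disjoint_steiner G S p T" for p T
  proof -
    have st: "steiner_tree G S (T i)" if "i < p" for i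
      using \<open>edge_disjoint_steiner G S p T\<close> that by (simp add: edge_disjoint_steiner_def)
    define a where "a i = (SOME e. e \<in> parcs (T i))" for i
    have a: "a i \<in> parcs (T i)" if "i < p" for i
      using steiner_tree_arcs_nonempty[OF st[OF that] assms(2)]
      unfolding a_def by (meson ex_in_conv someI_ex)
    have "inj_on a {..<p}"
      using a \<open>edge_disjoint_steiner G S p T\<close>
      by (fastforce simp: inj_on_def edge_disjoint_steiner_def)
    moreover have "a ` {..<p} \<subseteq> parcs G"
      using a st by (fastforce simp: steiner_tree_def subgraph_def)
    ultimately show ?thesis
      using card_inj_on_le[OF _ _ fin] by fastforce
  qed
  then have "{p. \<exists>T. edge_disjoint_steiner G S p T} \<subseteq> {..card (parcs G)}"
    by auto
  then show ?thesis using finite_subset by blast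
qed

lemma finite_internally_disjoint_steiner:
  assumes "pair_graph G" "2 \<le> card S"
  shows "finite {p. \<exists>T. internally_disjoint_steiner G S p T}"
proof -
  have "edge_disjoint_steiner G S p T" if "internally_disjoint_steiner G S p T" for p T
    using that by (simp add: internally_disjoint_steiner_def edge_disjoint_steiner_def)
  then have "{p. \<exists>T. internally_disjoint_steiner G S p T} \<subseteq> {p. \<exists>T. edge_disjoint_steiner G S p T}"
    by blast
  then show ?thesis
    using finite_edge_disjoint_steiner[OF assms] finite_subset by blast
qed

end

theory Submission
  imports Defs
begin

text \<open>
The graph \<open>S(n, l)\<close> consists of \<open>l\<close> copies of \<open>S(n - 1, l)\<close>, any two of them joined by exactly one
edge. Contracting the copies yields the complete graph \<open>K\<close> on \<open>l\<close> vertices, and the connectivities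
of \<open>S(n, l)\<close> are governed by those of \<open>K\<close>.

For the upper bounds, take terminals that meet \<open>a = min k l\<close> copies. Edge-disjoint Steiner trees
project to edge-disjoint connected subgraphs of \<open>K\<close> through \<open>a\<close> given vertices. Counting the
edges at these vertices shows that there are at most \<open>l - \<lceil>a / 2\<rceil>\<close> of them
(\<open>edge_disjoint_steiner_in_complete_graph\<close>), and this is \<open>\<lfloor>l / 2\<rfloor>\<close> for \<open>a = l\<close>.

The lower bound \<open>\<lfloor>l / 2\<rfloor>\<close> for the edge connectivity comes from edge-disjoint spanning trees:
\<open>K\<close> has \<open>\<lfloor>l / 2\<rfloor>\<close> of them, namely double stars, and they lift recursively
(\<open>edge_disjoint_spanning_parts\<close>).

The lower bound \<open>l - \<lceil>k / 2\<rceil>\<close> for \<open>k \<le> l\<close> needs internally disjoint trees. The number of trees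
stays the same in the recursion, while the terminals are distributed over the copies. The trees are
first routed through \<open>K\<close>. As long as there are empty copies, a tree takes one as a hub and joins it to
all copies with terminals; the remaining trees are double stars whose centres are copies with a
single terminal. A single terminal can be joined to all corners of its copy by disjoint paths, so
such a copy can serve a tree with many edges, whereas each tree enters a copy with several terminals
from just one other copy. What remains inside a copy is to find trees that contain its terminals and
that each reach given corners. The precise claim that survives the recursion is \<open>packing_exists\<close>,
with the invariant \<open>feasible\<close>, and its core is \<open>routing_many_copies\<close>.
\<close>

section \<open>Connected edge sets and spanning trees\<close>

text \<open>
If the pieces \<open>W i\<close> are connected and the quotient graph \<open>H\<close> on their indices is connected by
edges that lift, then the union is connected. The connected subgraphs for the lower bounds are
built in this way from pieces in the copies of a smaller Sierpinski graph.
\<close>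

lemma connected_by_union:
  assumes conn: "I \<times> I \<subseteq> H\<^sup>*" and H: "H \<subseteq> I \<times> I"
    and parts: "\<And>i. i \<in> I \<Longrightarrow> W i \<times> W i \<subseteq> E\<^sup>*"
    and links: "\<And>i j. (i, j) \<in> H \<Longrightarrow> \<exists>u\<in>W i. \<exists>v\<in>W j. (u, v) \<in> E"
  shows "(\<Union>i\<in>I. W i) \<times> (\<Union>i\<in>I. W i) \<subseteq> E\<^sup>*"
proof -
  have "\<forall>x\<in>W i. \<forall>y\<in>W j. (x, y) \<in> E\<^sup>*" if "(i, j) \<in> H\<^sup>*" "i \<in> I" for i j
    using that(1)
  proof (induction rule: rtrancl_induct)
    case base
    then show ?case using parts[OF that(2)] by auto
  next
    case (step j k)
    then obtain u v where uv: "u \<in> W j" "v \<in> W k" "(u, v) \<in> E" using links by blast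
    have "k \<in> I" using step.hyps(2) H by auto
    show ?case
    proof (intro ballI)
      fix x y assume "x \<in> W i" "y \<in> W k"
      have "(x, u) \<in> E\<^sup>*" using step.IH \<open>x \<in> W i\<close> uv(1) by blast
      moreover have "(v, y) \<in> E\<^sup>*" using parts[OF \<open>k \<in> I\<close>] uv(2) \<open>y \<in> W k\<close> by auto
      ultimately show "(x, y) \<in> E\<^sup>*"
        using uv(3) by (meson rtrancl.rtrancl_into_rtrancl rtrancl_trans)
    qed
  qed
  then show ?thesis using conn by blast
qed

lemma rtrancl_image:
  assumes "(x, y) \<in> E\<^sup>*" and "\<And>u v. (u, v) \<in> E \<Longrightarrow> (f u, f v) \<in> F\<^sup>*"
  shows "(f x, f y) \<in> F\<^sup>*"
  using assms(1) by induction (auto intro: assms(2) rtrancl_trans)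

lemma pcas_reaches: "pcas u p v \<Longrightarrow> (u, v) \<in> (set p)\<^sup>*"
proof (induction p arbitrary: u)
  case Nil
  then show ?case by simp
next
  case (Cons e es)
  then have "(snd e, v) \<in> (set (e # es))\<^sup>*"
    by (meson pcas.simps(2) rtrancl_mono set_subset_Cons subsetD)
  moreover have "(u, snd e) \<in> set (e # es)"
    using Cons.prems by (cases e) auto
  ultimately show ?case by (rule converse_rtrancl_into_rtrancl[rotated])
qed

lemma set_pawalk_verts:
  assumes "pcas u p v" "(x, y) \<in> set p"
  shows "x \<in> set (pawalk_verts u p) \<and> y \<in> set (tl (pawalk_verts u p))"
  using assms
proof (induction p arbitrary: u)
  case (Cons e es)
  show ?case
  proof (cases "e = (x, y)")
    case True
    then show ?thesis using Cons.prems(1) by (cases es) auto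
  next
    case False
    then have "(x, y) \<in> set es" using Cons.prems by auto
    moreover have "pcas (snd e) es v" using Cons.prems(1) by simp
    ultimately have "x \<in> set (pawalk_verts (snd e) es) \<and> y \<in> set (tl (pawalk_verts (snd e) es))"
      using Cons.IH by blast
    then show ?thesis by (auto dest: list.set_sel(2)[rotated])
  qed
qed simp

lemma pawalk_verts_last: "pcas u p v \<Longrightarrow> last (pawalk_verts u p) = v"
proof (induction p arbitrary: u)
  case (Cons e es)
  then show ?case by (cases es) auto
qed simp

text \<open>
The vertices of a cycle after the first are distinct, and there are at least three, so the rest of
the cycle leads from \<open>v\<close> back to \<open>u\<close> without the edge \<open>{u, v}\<close> in either direction. For length 2
this fails: the walk \<open>u, v, u\<close> uses one edge twice.
\<close>

lemma cycle_avoids_first_edge: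
  assumes "pcas u p u" "distinct (tl (pawalk_verts u p))" "3 \<le> length p"
  obtains v q where "p = (u, v) # q" "(u, v) \<notin> set q" "(v, u) \<notin> set q"
    "(v, u) \<in> (set q)\<^sup>*"
proof -
  obtain e q where p: "p = e # q" using assms(3) by (cases p) auto
  define v where "v = snd e"
  have e: "e = (u, v)" using assms(1) p v_def by (cases e) auto
  have q: "pcas v q u" using assms(1) p e by simp
  have d: "distinct (pawalk_verts v q)" using assms(2) p e by simp
  obtain f r where f: "q = f # r" "r \<noteq> []" using assms(3) p by (cases q) (auto simp: Suc_le_eq)
  obtain w where w: "f = (v, w)" "pcas w r u" using q f by (cases f) auto
  have vr: "v \<notin> set (pawalk_verts w r)" using d f w by simp
  have dr: "distinct (pawalk_verts w r)" using d f w by simp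
  have "u \<noteq> w"
  proof
    assume "u = w"
    obtain g s where g: "r = g # s" using f(2) by (cases r) auto
    have "last (pawalk_verts (snd g) s) = u" 
      using w(2) g pawalk_verts_last[of "snd g" s u] by simp
    moreover have "w \<notin> set (pawalk_verts (snd g) s)"
      using dr g w(2) by simp
    moreover have "pawalk_verts (snd g) s \<noteq> []" by (cases s) auto
    ultimately show False using \<open>u = w\<close> last_in_set by metis
  qed
  have "(v, u) \<notin> set q"
    using f w \<open>u \<noteq> w\<close> set_pawalk_verts[OF w(2), of v u] vr by auto
  moreover have "(u, v) \<notin> set q"
  proof
    assume "(u, v) \<in> set q"
    then have "v \<in> set (tl (pawalk_verts v q))" using set_pawalk_verts[OF q] by blast
    then show False using d f w by simp
  qed
  ultimately show ?thesis using that p e pcas_reaches[OF q] by blast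
qed

lemma pair_graphI:
  assumes "finite V" "E \<subseteq> V \<times> V" "sym E" "irrefl E"
  shows "pair_graph \<lparr>pverts = V, parcs = E\<rparr>"
proof -
  have "finite E" using assms(1,2) finite_subset by blast
  then show ?thesis
    using assms by unfold_locales (auto simp: symmetric_def irrefl_def)
qed

lemma connected_iff_rtrancl:
  assumes "pair_graph T"
  shows "connected (with_proj T) \<longleftrightarrow> pverts T \<noteq> {} \<and> pverts T \<times> pverts T \<subseteq> (parcs T)\<^sup>*"
proof -
  interpret pair_graph T by fact
  have s: "sym (parcs T)" using sym_arcs by (simp add: symmetric_def)
  have m: "parcs (mk_symmetric T) = parcs T"
    using s by (auto simp: mk_symmetric_def sym_def)
  have "reachable (with_proj (mk_symmetric T)) u v \<longleftrightarrow> (u, v) \<in> (parcs T)\<^sup>*"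
    if "u \<in> pverts T" "v \<in> pverts T" for u v
    using that unfolding reachable_def
    by (auto simp: m intro: rtrancl_on_rtranclI rtrancl_consistent_rtrancl_on wellformed')
  then show ?thesis
    unfolding connected_def strongly_connected_def by (auto)
qed

text \<open>
A symmetric connected arc set of least cardinality has no cycle of length at least 3, since an edge
of such a cycle can be removed, in both directions, without losing connectivity.
\<close>

lemma spanning_tree_exists:
  assumes V: "finite V" "V \<noteq> {}" and E: "E \<subseteq> V \<times> V" "sym E" "irrefl E"
    and conn: "V \<times> V \<subseteq> E\<^sup>*"
  shows "\<exists>F\<subseteq>E. undirected_tree \<lparr>pverts = V, parcs = F\<rparr>"
proof -
  define good where "good F \<longleftrightarrow> F \<subseteq> E \<and> sym F \<and> V \<times> V \<subseteq> F\<^sup>*" for F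
  have finE: "finite E" using V(1) E(1) finite_subset by blast
  have "good E" using E conn by (simp add: good_def)
  then obtain F where F: "good F" and min: "\<And>F'. good F' \<Longrightarrow> card F \<le> card F'"
    using ex_has_least_nat[of good E card] by blast
  have FE: "F \<subseteq> E" "sym F" "V \<times> V \<subseteq> F\<^sup>*" using F by (auto simp: good_def)
  have pg: "pair_graph \<lparr>pverts = V, parcs = F\<rparr>"
    using V E FE by (intro pair_graphI) (auto simp: irrefl_def)
  have "\<not> 3 \<le> length p" if c: "pre_digraph.cycle (with_proj \<lparr>pverts = V, parcs = F\<rparr>) p" for p
  proof
    assume "3 \<le> length p"
    obtain u where u: "pcas u p u" "distinct (tl (pawalk_verts u p))" "set p \<subseteq> F"
      using c by (auto simp: pre_digraph.cycle_def pre_digraph.awalk_def cas_with_proj_eq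
          awalk_verts_with_proj_eq)
    obtain v q where q: "p = (u, v) # q" "(u, v) \<notin> set q" "(v, u) \<notin> set q"
      "(v, u) \<in> (set q)\<^sup>*"
      using cycle_avoids_first_edge[OF u(1,2) \<open>3 \<le> length p\<close>] by metis
    define F' where "F' = F - {(u, v), (v, u)}"
    have s': "sym F'" using FE(2) by (auto simp: F'_def sym_def)
    have "set q \<subseteq> F'" using q u(3) by (auto simp: F'_def)
    then have vu: "(v, u) \<in> F'\<^sup>*" using q(4) rtrancl_mono by blast
    moreover have "(u, v) \<in> F'\<^sup>*" using vu s' by (meson sym_rtrancl symD)
    ultimately have "F \<subseteq> F'\<^sup>*" by (auto simp: F'_def)
    then have "F\<^sup>* \<subseteq> F'\<^sup>*" using rtrancl_subset_rtrancl by blast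
    then have "good F'" using FE s' by (auto simp: good_def F'_def)
    then have "card F \<le> card F'" using min by blast
    moreover have "card F' < card F"
      using q(1) u(3) finE FE(1) finite_subset[of F E]
      by (intro psubset_card_mono) (auto simp: F'_def)
    ultimately show False by simp
  qed
  then have "undirected_tree \<lparr>pverts = V, parcs = F\<rparr>"
    unfolding undirected_tree_def connected_iff_rtrancl[OF pg] using pg V(2) FE(3) by auto
  then show ?thesis using FE(1) by blast
qed

text \<open>
Thanks to this lemma, a Steiner tree may be built as any connected subgraph: passing to a
spanning tree keeps the vertices and can only remove edges, so it preserves both kinds of
disjointness.
\<close>

lemma steiner_tree_exists:
  assumes G: "pair_graph G" and V: "V \<subseteq> pverts G" "V \<noteq> {}" "S \<subseteq> V"
    and E: "E \<subseteq> parcs G" "E \<subseteq> V \<times> V" "sym E" "V \<times> V \<subseteq> E\<^sup>*"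
  shows "\<exists>T. steiner_tree G S T \<and> pverts T = V \<and> parcs T \<subseteq> E"
proof -
  interpret pair_graph G by fact
  have fin: "finite V" using V(1) by (rule finite_subset) simp
  have irr: "irrefl E" using E(1) no_loops' by (auto simp: irrefl_def)
  obtain F where F: "F \<subseteq> E" "undirected_tree \<lparr>pverts = V, parcs = F\<rparr>"
    using spanning_tree_exists[OF fin V(2) E(2,3) irr E(4)] by blast
  interpret T: pair_graph "\<lparr>pverts = V, parcs = F\<rparr>"
    using F(2) by (simp add: undirected_tree_def)
  have "subgraph (with_proj \<lparr>pverts = V, parcs = F\<rparr>) (with_proj G)"
    using V(1) E(1) F(1) T.wf_digraph wf_digraph by (auto simp: subgraph_def compatible_def)
  then show ?thesis
    using F V(3) by (intro exI[of _ "\<lparr>pverts = V, parcs = F\<rparr>"]) (simp add: steiner_tree_def)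
qed

lemma steiner_treeD:
  assumes "steiner_tree G S T"
  shows "parcs T \<subseteq> parcs G" "pverts T \<subseteq> pverts G" "S \<subseteq> pverts T" "sym (parcs T)"
    "parcs T \<subseteq> pverts T \<times> pverts T" "pverts T \<times> pverts T \<subseteq> (parcs T)\<^sup>*"
proof -
  have T: "pair_graph T" "connected (with_proj T)" "subgraph (with_proj T) (with_proj G)" "S \<subseteq> pverts T"
    using assms by (auto simp: steiner_tree_def undirected_tree_def)
  interpret pair_graph T by fact
  show "parcs T \<subseteq> parcs G" "pverts T \<subseteq> pverts G" "S \<subseteq> pverts T"
    using T(3,4) by (auto simp: subgraph_def)
  show "sym (parcs T)" using sym_arcs by (simp add: symmetric_def)
  show "parcs T \<subseteq> pverts T \<times> pverts T" using wellformed' by auto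
  show "pverts T \<times> pverts T \<subseteq> (parcs T)\<^sup>*" using connected_iff_rtrancl[OF T(1)] T(2) by simp
qed

section \<open>Recursive structure of Sierpinski graphs\<close>

lemma Cons_in_pverts_sierpinski [simp]:
  "i # u \<in> pverts (sierpinski (Suc n) l) \<longleftrightarrow> i < l \<and> u \<in> pverts (sierpinski n l)"
  by (auto simp: pverts_sierpinski)

lemma pverts_sierpinski_Suc:
  "pverts (sierpinski (Suc n) l) = (\<Union>i<l. (#) i ` pverts (sierpinski n l))"
  by (auto simp: pverts_sierpinski length_Suc_conv)

lemma replicate_in_pverts_sierpinski [simp]:
  "i < l \<Longrightarrow> replicate n i \<in> pverts (sierpinski n l)"
  by (auto simp: pverts_sierpinski)

text \<open>
The graph consists of one copy of the next smaller graph for each first letter, and each pair of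
copies \<open>i\<close>, \<open>j\<close> is joined by a single edge, from corner \<open>j\<close> of copy \<open>i\<close> to corner \<open>i\<close> of
copy \<open>j\<close>.
\<close>

lemma parcs_sierpinski_Cons:
  "(i # u, j # v) \<in> parcs (sierpinski (Suc n) l) \<longleftrightarrow>
     i < l \<and> j < l \<and>
     (i = j \<and> (u, v) \<in> parcs (sierpinski n l) \<or>
      i \<noteq> j \<and> u = replicate n j \<and> v = replicate n i)"
proof (cases "i # u \<in> pverts (sierpinski (Suc n) l) \<and> j # v \<in> pverts (sierpinski (Suc n) l)")
  case True
  then have V: "i < l" "j < l" "u \<in> pverts (sierpinski n l)" "v \<in> pverts (sierpinski n l)" by simp_all
  then have len: "length u = n" "length v = n" by (auto simp: pverts_sierpinski)
  have shift: "(\<forall>k. Suc d < k \<and> k < Suc n \<longrightarrow> P k) \<longleftrightarrow> (\<forall>k. d < k \<and> k < n \<longrightarrow> P (Suc k))" for d P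
    by (metis Suc_less_eq Suc_lessE)
  have shift0: "(\<forall>k. 0 < k \<and> k < Suc n \<longrightarrow> P k) \<longleftrightarrow> (\<forall>k<n. P (Suc k))" for P
    by (metis Suc_less_eq gr0_conv_Suc zero_less_Suc)
  have rep: "(\<forall>k<n. u ! k = j \<and> v ! k = i) \<longleftrightarrow> u = replicate n j \<and> v = replicate n i"
    using len by (auto simp: list_eq_iff_nth_eq)
  show ?thesis
    unfolding in_parcs_sierpinski Ex_less_Suc2 All_less_Suc2 shift shift0
    using True V rep by auto
next
  case False
  then show ?thesis
    by (auto simp: in_parcs_sierpinski)
qed

lemma parcs_sierpinskiE:
  assumes "(x, y) \<in> parcs (sierpinski (Suc n) l)"
  obtains (copy) i u v where "i < l" "x = i # u" "y = i # v" "(u, v) \<in> parcs (sierpinski n l)"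
    | (link) i j where "i < l" "j < l" "i \<noteq> j" "x = i # replicate n j" "y = j # replicate n i"
proof -
  have "x \<in> pverts (sierpinski (Suc n) l)" "y \<in> pverts (sierpinski (Suc n) l)"
    using assms in_parcs_sierpinski by blast+
  then obtain i u j v where "x = i # u" "y = j # v"
    by (auto simp: pverts_sierpinski length_Suc_conv)
  with assms that show ?thesis by (auto simp: parcs_sierpinski_Cons)
qed

lemma sym_parcs_sierpinski: "sym (parcs (sierpinski n l))"
proof -
  interpret pair_graph "sierpinski n l" by (rule pair_graph_sierpinski)
  show ?thesis using sym_arcs by (simp add: symmetric_def)
qed

lemma finite_pverts_sierpinski: "finite (pverts (sierpinski n l))"
proof -
  interpret pair_graph "sierpinski n l" by (rule pair_graph_sierpinski)
  show ?thesis by simp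
qed

section \<open>The upper bound\<close>

text \<open>
Every vertex of \<open>A\<close> other than \<open>z\<close> owns the first edge of a shortest path to \<open>z\<close>. No edge is owned
from both ends, because distances to \<open>z\<close> decrease. An edge inside \<open>A\<close> consists of two arcs of
\<open>A \<times> A\<close>, while an edge leaving \<open>A\<close> has just one arc starting in \<open>A\<close>, hence the weights.
\<close>

lemma card_edges_touching:
  fixes H :: "('a \<times> 'a) set"
  assumes H: "finite H" "sym H" and A: "finite A" and reach: "\<And>x. x \<in> A \<Longrightarrow> (x, z) \<in> H\<^sup>*"
  shows "2 * card (A - {z}) \<le> card (H \<inter> A \<times> A) + 2 * card (H \<inter> A \<times> (- A))"
proof -
  define dist where "dist x = (LEAST m. (x, z) \<in> H ^^ m)" for x
  have "\<exists>y. (x, y) \<in> H \<and> dist y < dist x" if x: "x \<in> A" "x \<noteq> z" for x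
  proof -
    have "\<exists>m. (x, z) \<in> H ^^ m" using reach[OF x(1)] by (simp add: rtrancl_is_UN_relpow)
    then have d: "(x, z) \<in> H ^^ dist x" unfolding dist_def by (rule LeastI_ex)
    then obtain m where m: "dist x = Suc m" using x(2) by (cases "dist x") auto
    with d obtain y where y: "(x, y) \<in> H" "(y, z) \<in> H ^^ m" by (metis relpow_Suc_D2)
    then have "dist y \<le> m" unfolding dist_def by (simp add: Least_le)
    then show ?thesis using y m by auto
  qed
  then obtain par where par: "\<And>x. x \<in> A \<Longrightarrow> x \<noteq> z \<Longrightarrow> (x, par x) \<in> H \<and> dist (par x) < dist x"
    by metis
  define B where "B = {x \<in> A - {z}. par x \<in> A}"
  define C where "C = {x \<in> A - {z}. par x \<notin> A}"
  have BC: "A - {z} = B \<union> C" "B \<inter> C = {}" by (auto simp: B_def C_def)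
  have fin: "finite B" "finite C" using A by (auto simp: B_def C_def)
  let ?P = "(\<lambda>x. (x, par x)) ` B" and ?Q = "(\<lambda>x. (par x, x)) ` B"
  have "?P \<inter> ?Q = {}"
  proof (rule ccontr)
    assume "?P \<inter> ?Q \<noteq> {}"
    then obtain x y where xy: "x \<in> B" "y \<in> B" "par x = y" "par y = x" by auto
    then have "dist y < dist x" "dist x < dist y" using par[of x] par[of y] by (auto simp: B_def)
    then show False by simp
  qed
  then have "card (?P \<union> ?Q) = 2 * card B"
    using fin by (simp add: card_Un_disjoint card_image inj_on_def)
  moreover have "?P \<union> ?Q \<subseteq> H \<inter> A \<times> A"
    using par H(2) by (auto simp: B_def dest: symD)
  ultimately have 1: "2 * card B \<le> card (H \<inter> A \<times> A)"
    using card_mono[of "H \<inter> A \<times> A" "?P \<union> ?Q"] H(1) by simp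
  have "(\<lambda>x. (x, par x)) ` C \<subseteq> H \<inter> A \<times> (- A)" using par by (auto simp: C_def)
  then have "card C \<le> card (H \<inter> A \<times> (- A))"
    using H(1) by (intro card_inj_on_le[of "\<lambda>x. (x, par x)"]) (auto simp: inj_on_def)
  moreover have "card (A - {z}) = card B + card C" using BC fin by (simp add: card_Un_disjoint)
  ultimately show ?thesis using 1 by simp
qed

lemma sum_card_disjoint_le:
  assumes "finite X" "\<And>s t. s < p \<Longrightarrow> t < p \<Longrightarrow> s \<noteq> t \<Longrightarrow> F s \<inter> F t = {}"
    and "\<And>t. t < (p::nat) \<Longrightarrow> F t \<subseteq> X"
  shows "(\<Sum>t<p. card (F t)) \<le> card X"
proof -
  have "finite (F t)" if "t < p" for t using that assms(1,3) finite_subset by blast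
  then have "(\<Sum>t<p. card (F t)) = card (\<Union>t<p. F t)"
    using assms(2) by (intro card_UN_disjoint[symmetric]) auto
  also have "\<dots> \<le> card X" using assms by (intro card_mono) auto
  finally show ?thesis .
qed

text \<open>
Count the edges of the complete graph that meet \<open>A\<close>, where \<open>a = card A\<close>. A tree that leaves \<open>A\<close>
uses at least \<open>a\<close> of them, by the preceding lemma with \<open>z\<close> outside \<open>A\<close>; a tree that does not
uses at least \<open>a - 1\<close>, all of them inside \<open>A\<close>, so that there are at most \<open>a / 2\<close> such trees. Altogether
only \<open>a (a - 1) / 2 + a (l - a)\<close> edges meet \<open>A\<close>. The proof counts arcs, that is, twice these numbers.
\<close>

lemma edge_disjoint_steiner_in_complete_graph:
  fixes H :: "nat \<Rightarrow> (nat \<times> nat) set"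
  assumes A: "A \<subseteq> {..<l}" "2 \<le> card A"
    and H: "\<And>t. t < p \<Longrightarrow> H t \<subseteq> {..<l} \<times> {..<l} - Id" "\<And>t. t < p \<Longrightarrow> sym (H t)"
    and conn: "\<And>t. t < p \<Longrightarrow> A \<times> A \<subseteq> (H t)\<^sup>*"
    and disj: "\<And>s t. s < p \<Longrightarrow> t < p \<Longrightarrow> s \<noteq> t \<Longrightarrow> H s \<inter> H t = {}"
  shows "2 * p + card A \<le> 2 * l"
proof -
  define a where "a = card A"
  have finA: "finite A" using A(1) finite_subset by blast
  have al: "a \<le> l" using card_mono[OF _ A(1)] by (simp add: a_def)
  have finH: "finite (H t)" if "t < p" for t
    using H(1)[OF that] finite_subset[of "H t" "{..<l} \<times> {..<l}"] by auto
  define inn where "inn t \<longleftrightarrow> H t \<inter> A \<times> (- A) = {}" for t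
  define I where "I = {t. t < p \<and> inn t}"
  define f where "f t = card (H t \<inter> A \<times> A)" for t
  define g where "g t = card (H t \<inter> A \<times> (- A))" for t
  have finI: "finite I" by (simp add: I_def)
  have w: "2 * a \<le> f t + 2 * g t + (if inn t then 2 else 0)" if t: "t < p" for t
  proof (cases "inn t")
    case True
    obtain z where z: "z \<in> A" using A(2) by fastforce
    have "2 * card (A - {z}) \<le> f t + 2 * g t"
      unfolding f_def g_def
      using conn[OF t] z by (intro card_edges_touching finH H(2) t finA) auto
    then show ?thesis using True z finA by (simp add: a_def)
  next
    case False
    then obtain x z where xz: "(x, z) \<in> H t" "x \<in> A" "z \<notin> A" by (auto simp: inn_def)
    have "2 * card (A - {z}) \<le> f t + 2 * g t"
      unfolding f_def g_def
    proof (intro card_edges_touching finH H(2) t finA)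
      fix y assume "y \<in> A"
      then show "(y, z) \<in> (H t)\<^sup>*"
        using conn[OF t] xz by (meson SigmaI rtrancl.rtrancl_into_rtrancl subsetD)
    qed
    then show ?thesis using False xz(3) by (simp add: a_def)
  qed
  have sf: "(\<Sum>t<p. f t) \<le> a * (a - 1)"
  proof -
    have "(\<Sum>t<p. f t) \<le> card (A \<times> A - (\<lambda>x. (x, x)) ` A)"
      unfolding f_def using finA disj H(1) by (intro sum_card_disjoint_le) blast+
    also have "\<dots> = a * a - a"
      using finA by (subst card_Diff_subset) (auto simp: a_def card_image inj_on_def)
    finally show ?thesis by (simp add: diff_mult_distrib2)
  qed
  have sg: "(\<Sum>t<p. g t) \<le> a * (l - a)"
  proof -
    have "(\<Sum>t<p. g t) \<le> card (A \<times> ({..<l} - A))"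
      unfolding g_def using finA disj H(1) by (intro sum_card_disjoint_le) blast+
    also have "\<dots> = a * (l - a)"
      using finA A(1) by (simp add: card_cartesian_product card_Diff_subset a_def)
    finally show ?thesis .
  qed
  have "(\<Sum>t\<in>I. 2 * (a - 1)) \<le> (\<Sum>t\<in>I. f t)"
  proof (rule sum_mono)
    fix t assume "t \<in> I"
    then show "2 * (a - 1) \<le> f t" using w[of t] by (auto simp: I_def inn_def g_def)
  qed
  also have "\<dots> \<le> (\<Sum>t<p. f t)" by (rule sum_mono2) (auto simp: I_def)
  also note sf
  finally have "card I * 2 * (a - 1) \<le> a * (a - 1)" by (simp add: mult.assoc)
  moreover have "0 < a - 1" using A(2) by (simp add: a_def)
  ultimately have "card I * 2 \<le> a" by (simp only: mult_le_cancel2)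
  then have I: "2 * card I \<le> a" by simp
  have "(\<Sum>t<p. 2 * a) \<le> (\<Sum>t<p. f t + 2 * g t + (if inn t then 2 else 0))"
    using w by (intro sum_mono) simp
  also have "\<dots> = (\<Sum>t<p. f t) + 2 * (\<Sum>t<p. g t) + 2 * card I"
    by (simp add: sum.distrib sum_distrib_left sum.If_cases I_def Int_def)
  also have "\<dots> \<le> a * (a - 1) + 2 * (a * (l - a)) + a" using sf sg I by linarith
  also have "\<dots> = a * (2 * l - a)"
  proof -
    obtain b where "a = Suc b" using A(2) by (cases a) (auto simp: a_def)
    moreover obtain d where "l = a + d" using al le_Suc_ex by blast
    ultimately show ?thesis by (simp add: algebra_simps)
  qed
  finally have "a * (2 * p) \<le> a * (2 * l - a)" by (simp add: ac_simps)
  then have "2 * p \<le> 2 * l - a" using A(2) by (auto simp: a_def)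
  then show ?thesis using al by (simp add: a_def)
qed

text \<open>
Contracting each copy to a point maps the trees to edge-disjoint connected subgraphs of the
complete graph on the copies.
\<close>

lemma edge_disjoint_steiner_sierpinski_le:
  assumes T: "edge_disjoint_steiner (sierpinski (Suc n) l) S p T"
    and S: "S \<subseteq> pverts (sierpinski (Suc n) l)" and A: "2 \<le> card (hd ` S)"
  shows "2 * p + card (hd ` S) \<le> 2 * l"
proof -
  define H where "H t = {(hd u, hd v) | u v. (u, v) \<in> parcs (T t) \<and> hd u \<noteq> hd v}" for t
  have st: "steiner_tree (sierpinski (Suc n) l) S (T t)" if "t < p" for t
    using T that by (auto simp: edge_disjoint_steiner_def)
  note tree = steiner_treeD[OF st]
  have hd_l: "hd u < l" if "u \<in> pverts (sierpinski (Suc n) l)" for u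
    using that by (auto simp: pverts_sierpinski_Suc)
  have Hl: "H t \<subseteq> {..<l} \<times> {..<l} - Id" if t: "t < p" for t
    using tree(1,2,5)[OF t] by (auto simp: H_def intro!: hd_l)
  \<comment> \<open>Only one edge joins two given copies, so the projection loses no information about the edges
    between copies; this is what keeps the projected trees edge-disjoint.\<close>
  have lift: "(i # replicate n j, j # replicate n i) \<in> parcs (T t)"
    if t: "t < p" and ij: "(i, j) \<in> H t" for t i j
  proof -
    obtain u v where uv: "(u, v) \<in> parcs (T t)" "hd u = i" "hd v = j" "i \<noteq> j"
      using ij by (auto simp: H_def)
    then have "(u, v) \<in> parcs (sierpinski (Suc n) l)" using tree(1)[OF t] by blast
    then show ?thesis using uv by (cases rule: parcs_sierpinskiE) auto
  qed
  show ?thesis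
  proof (rule edge_disjoint_steiner_in_complete_graph[where H = H])
    show "hd ` S \<subseteq> {..<l}" using S hd_l by auto
    show "2 \<le> card (hd ` S)" by (rule A)
    show "H t \<subseteq> {..<l} \<times> {..<l} - Id" if "t < p" for t by (rule Hl[OF that])
    show "sym (H t)" if "t < p" for t
    proof (rule symI)
      fix i j assume "(i, j) \<in> H t"
      then obtain u v where "(u, v) \<in> parcs (T t)" "i = hd u" "j = hd v" "j \<noteq> i" by (auto simp: H_def)
      moreover then have "(v, u) \<in> parcs (T t)" using tree(4)[OF that] by (meson symD)
      ultimately show "(j, i) \<in> H t" unfolding H_def by blast
    qed
    show "hd ` S \<times> hd ` S \<subseteq> (H t)\<^sup>*" if t: "t < p" for t
    proof clarify
      fix x y assume "x \<in> S" "y \<in> S"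
      then have "(x, y) \<in> (parcs (T t))\<^sup>*" using tree(3,6)[OF t] by blast
      then show "(hd x, hd y) \<in> (H t)\<^sup>*"
      proof (rule rtrancl_image)
        fix u v assume "(u, v) \<in> parcs (T t)"
        then show "(hd u, hd v) \<in> (H t)\<^sup>*"
          by (cases "hd u = hd v") (auto simp: H_def)
      qed
    qed
    show "H s \<inter> H t = {}" if st: "s < p" "t < p" "s \<noteq> t" for s t
    proof -
      have "parcs (T s) \<inter> parcs (T t) = {}" using T st by (auto simp: edge_disjoint_steiner_def)
      then show ?thesis using lift[OF st(1)] lift[OF st(2)] by fast
    qed
  qed
qed

section \<open>Edge-disjoint double stars\<close>

text \<open>
Edge-disjoint spanning trees of a complete graph on \<open>{..<a}\<close>, where \<open>2 * r \<le> a\<close>: tree \<open>j < r\<close> is a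
double star with centres \<open>j\<close> and \<open>r + j\<close>. Of the four edges between the centres of trees \<open>i < j\<close>,
tree \<open>i\<close> takes \<open>{i, j}\<close> and \<open>{r + i, r + j}\<close>, and tree \<open>j\<close> takes the other two. A vertex
\<open>x \<ge> 2 * r\<close> is a leaf at \<open>j\<close>. For \<open>x < y\<close> the function gives the tree that contains the edge
\<open>{x, y}\<close>; a value of at least \<open>r\<close> means none. Describing the trees by a function on edges
makes them edge-disjoint by construction.
\<close>

definition double_star_index :: "nat \<Rightarrow> nat \<Rightarrow> nat \<Rightarrow> nat" where
  "double_star_index r x y =
     (if y < r \<or> 2 * r \<le> y then x else if x < r then max x (y - r) else x - r)"

text \<open>
Copies with several terminals can only afford one edge for each tree. They will lie outside \<open>B\<close>, and
the last property makes them leaves of all trees.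
\<close>

lemma double_stars:
  assumes A: "finite A" and B: "B \<subseteq> A" "card B = 2 * r"
  obtains H where "\<And>j. j < r \<Longrightarrow> H j \<subseteq> A \<times> A - Id" "\<And>j. j < r \<Longrightarrow> sym (H j)"
    "\<And>j. j < r \<Longrightarrow> A \<times> A \<subseteq> (H j)\<^sup>*"
    "\<And>i j. i \<noteq> j \<Longrightarrow> H i \<inter> H j = {}"
    "\<And>j x. j < r \<Longrightarrow> x \<in> A - B \<Longrightarrow> \<exists>y. H j `` {x} = {y}"
proof -
  define a where "a = card A"
  have a: "2 * r \<le> a" using card_mono[OF A B(1)] B(2) by (simp add: a_def)
  obtain f where f: "bij_betw f {..<2 * r} B"
    using B A finite_subset by (metis card_lessThan finite_lessThan finite_same_card_bij)
  obtain g where g: "bij_betw g {2 * r..<a} (A - B)"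
    using A B finite_subset[OF B(1) A]
    by (metis a_def card_Diff_subset card_atLeastLessThan finite_Diff finite_atLeastLessThan
        finite_same_card_bij)
  define b where "b x = (if x < 2 * r then f x else g x)" for x
  have b1: "bij_betw b {..<2 * r} B"
    using f by (rule bij_betw_cong[THEN iffD1, rotated]) (simp add: b_def)
  have b2: "bij_betw b {2 * r..<a} (A - B)"
    using g by (rule bij_betw_cong[THEN iffD1, rotated]) (simp add: b_def)
  have "bij_betw b ({..<2 * r} \<union> {2 * r..<a}) (B \<union> (A - B))"
    using b1 b2 by (rule bij_betw_combine) auto
  moreover have "{..<2 * r} \<union> {2 * r..<a} = {..<a}" "B \<union> (A - B) = A" using a B(1) by auto
  ultimately have b: "bij_betw b {..<a} A" by simp
  define D where "D j = {(x, y). x < a \<and> y < a \<and> x \<noteq> y \<and>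
    double_star_index r (min x y) (max x y) = j}" for j
  define H where "H j = {(b x, b y) | x y. (x, y) \<in> D j}" for j
  have inj: "x = y" if "b x = b y" "x < a" "y < a" for x y
    using b that by (auto simp: bij_betw_def inj_on_def)
  have symD': "sym (D j)" for j
    by (auto simp: D_def sym_def min.commute max.commute)
  have centre: "(j, x) \<in> (D j)\<^sup>*" if j: "j < r" and x: "x < a" for j x
  proof -
    consider "x = j" | "x < j" | "j < x" "x < r" | "r \<le> x" "x < 2 * r" "x - r \<le> j"
      | "r \<le> x" "x < 2 * r" "j < x - r" | "2 * r \<le> x"
      by linarith
    then show ?thesis
    proof cases
      case 2
      then have "(j, r + j) \<in> D j" "(r + j, x) \<in> D j"
        using j x a by (auto simp: D_def double_star_index_def min_def max_def)
      then show ?thesis by (meson converse_rtrancl_into_rtrancl r_into_rtrancl)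
    next
      case 5
      then have "(j, r + j) \<in> D j" "(r + j, x) \<in> D j"
        using j x a by (auto simp: D_def double_star_index_def min_def max_def)
      then show ?thesis by (meson converse_rtrancl_into_rtrancl r_into_rtrancl)
    next
      case 1
      then show ?thesis by simp
    next
      case 3
      then have "(j, x) \<in> D j" using j x by (auto simp: D_def double_star_index_def)
      then show ?thesis by blast
    next
      case 4
      then have "(j, x) \<in> D j" using j x by (auto simp: D_def double_star_index_def max_def)
      then show ?thesis by blast
    next
      case 6
      then have "(j, x) \<in> D j" using j x by (auto simp: D_def double_star_index_def)
      then show ?thesis by blast
    qed
  qed
  show thesis
  proof (rule that[of H])
    fix j assume j: "j < r"
    show "H j \<subseteq> A \<times> A - Id"
      using b inj by (auto simp: H_def D_def bij_betw_def)
    show "sym (H j)"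
      using symD'[of j] by (auto simp: H_def sym_def)
    have "(b x, b y) \<in> (H j)\<^sup>*" if "x < a" "y < a" for x y
    proof (rule rtrancl_image[where f = b and E = "D j"])
      have "(x, j) \<in> (D j)\<^sup>*" using centre[OF j that(1)] symD' by (meson sym_rtrancl symD)
      then show "(x, y) \<in> (D j)\<^sup>*" using centre[OF j that(2)] by (rule rtrancl_trans)
    qed (auto simp: H_def)
    moreover have "A = b ` {..<a}" using b by (simp add: bij_betw_def)
    ultimately show "A \<times> A \<subseteq> (H j)\<^sup>*" by auto
    show "\<exists>y. H j `` {x} = {y}" if x: "x \<in> A - B" for x
    proof -
      have "x \<in> b ` {2 * r..<a}" using x b2 by (simp add: bij_betw_def)
      then obtain k where k: "2 * r \<le> k" "k < a" "x = b k" by auto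
      have "(k, y) \<in> D j \<longleftrightarrow> y = j" for y
        using k j by (auto simp: D_def double_star_index_def min_def max_def)
      moreover have "(x, z) \<in> H j \<longleftrightarrow> (\<exists>y. z = b y \<and> (k, y) \<in> D j)" for z
      proof
        assume "(x, z) \<in> H j"
        then obtain k' y where y: "b k = b k'" "z = b y" "(k', y) \<in> D j"
          using k(3) unfolding H_def by auto
        then have "k = k'" using k(2) inj unfolding D_def by blast
        then show "\<exists>y. z = b y \<and> (k, y) \<in> D j" using y by blast
      next
        assume "\<exists>y. z = b y \<and> (k, y) \<in> D j"
        then show "(x, z) \<in> H j" using k(3) unfolding H_def by blast
      qed
      ultimately have "H j `` {x} = {b j}" by (auto simp: Image_singleton)
      then show ?thesis by blast
    qed
  next
    fix i j :: nat assume ij: "i \<noteq> j"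
    show "H i \<inter> H j = {}"
    proof (rule ccontr)
      assume "H i \<inter> H j \<noteq> {}"
      then obtain x y x' y' where xy: "(x, y) \<in> D i" "(x', y') \<in> D j" "b x = b x'" "b y = b y'"
        unfolding H_def by blast
      then have "x = x'" "y = y'" using inj unfolding D_def by blast+
      then show False using xy ij by (simp add: D_def)
    qed
  qed
qed

section \<open>Gluing connected pieces of the copies\<close>

definition connected_part :: "'a pair_pre_digraph \<Rightarrow> 'a set \<Rightarrow> ('a \<times> 'a) set \<Rightarrow> bool" where
  "connected_part G V E \<longleftrightarrow>
     V \<subseteq> pverts G \<and> E \<subseteq> parcs G \<and> E \<subseteq> V \<times> V \<and> sym E \<and> V \<times> V \<subseteq> E\<^sup>*"

text \<open>
The subgraph that consists of the piece \<open>W i\<close>, with arcs \<open>F i\<close>, in each copy \<open>i \<in> I\<close> and of the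
edges between copies that are listed in \<open>H\<close>.
\<close>

definition glued_verts :: "nat set \<Rightarrow> (nat \<Rightarrow> nat list set) \<Rightarrow> nat list set" where
  "glued_verts I W = {i # u | i u. i \<in> I \<and> u \<in> W i}"

definition glued_arcs ::
    "nat \<Rightarrow> nat set \<Rightarrow> (nat \<Rightarrow> (nat list \<times> nat list) set) \<Rightarrow> (nat \<times> nat) set \<Rightarrow> (nat list \<times> nat list) set" where
  "glued_arcs n I F H = {(i # u, i # v) | i u v. i \<in> I \<and> (u, v) \<in> F i} \<union>
     {(i # replicate n j, j # replicate n i) | i j. (i, j) \<in> H}"

lemma Cons_in_glued_verts [simp]: "i # u \<in> glued_verts I W \<longleftrightarrow> i \<in> I \<and> u \<in> W i"
  by (simp add: glued_verts_def)

lemma glued_arcsE: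
  assumes "(x, y) \<in> glued_arcs n I F H"
  obtains (copy) i u v where "x = i # u" "y = i # v" "i \<in> I" "(u, v) \<in> F i"
    | (link) i j where "x = i # replicate n j" "y = j # replicate n i" "(i, j) \<in> H"
  using assms unfolding glued_arcs_def by blast

lemma connected_part_glued:
  assumes I: "I \<subseteq> {..<l}" and H: "H \<subseteq> I \<times> I - Id" "sym H" "I \<times> I \<subseteq> H\<^sup>*"
    and part: "\<And>i. i \<in> I \<Longrightarrow> connected_part (sierpinski n l) (W i) (F i)"
    and corner: "\<And>i j. (i, j) \<in> H \<Longrightarrow> replicate n j \<in> W i"
  shows "connected_part (sierpinski (Suc n) l) (glued_verts I W) (glued_arcs n I F H)"
proof -
  note part = part[unfolded connected_part_def]
  let ?E = "glued_arcs n I F H"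
  have sym: "(j, i) \<in> H" if "(i, j) \<in> H" for i j using H(2) that by (meson symD)
  have "glued_verts I W \<subseteq> pverts (sierpinski (Suc n) l)"
    using I part by (fastforce simp: glued_verts_def)
  moreover have "?E \<subseteq> parcs (sierpinski (Suc n) l)"
  proof (rule subrelI)
    fix x y assume "(x, y) \<in> ?E"
    then show "(x, y) \<in> parcs (sierpinski (Suc n) l)"
    proof (cases rule: glued_arcsE)
      case (copy i u v)
      then show ?thesis using I part[of i] by (auto simp: parcs_sierpinski_Cons)
    next
      case (link i j)
      then show ?thesis using I H(1) by (auto simp: parcs_sierpinski_Cons)
    qed
  qed
  moreover have "?E \<subseteq> glued_verts I W \<times> glued_verts I W"
  proof (rule subrelI)
    fix x y assume "(x, y) \<in> ?E"
    then show "(x, y) \<in> glued_verts I W \<times> glued_verts I W"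
    proof (cases rule: glued_arcsE)
      case (copy i u v)
      then show ?thesis using part[of i] by auto
    next
      case (link i j)
      then show ?thesis using corner[of i j] corner[of j i] sym[of i j] H(1) by auto
    qed
  qed
  moreover have "sym ?E"
  proof (rule symI)
    fix x y assume "(x, y) \<in> ?E"
    then show "(y, x) \<in> ?E"
      unfolding glued_arcs_def using sym part by (blast dest: symD)
  qed
  moreover have "glued_verts I W \<times> glued_verts I W \<subseteq> ?E\<^sup>*"
  proof -
    have "(\<Union>i\<in>I. (#) i ` W i) \<times> (\<Union>i\<in>I. (#) i ` W i) \<subseteq> ?E\<^sup>*"
    proof (rule connected_by_union[OF H(3)])
      show "H \<subseteq> I \<times> I" using H(1) by blast
      show "(#) i ` W i \<times> (#) i ` W i \<subseteq> ?E\<^sup>*" if i: "i \<in> I" for i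
      proof clarify
        fix u v assume "u \<in> W i" "v \<in> W i"
        then have "(u, v) \<in> (F i)\<^sup>*" using part[OF i] by blast
        then show "(i # u, i # v) \<in> ?E\<^sup>*"
          by (rule rtrancl_image[where f = "(#) i" and E = "F i"]) (use i in \<open>auto simp: glued_arcs_def\<close>)
      qed
      show "\<exists>u\<in>(#) i ` W i. \<exists>v\<in>(#) j ` W j. (u, v) \<in> ?E" if ij: "(i, j) \<in> H" for i j
        using corner[OF ij] corner[OF sym[OF ij]] ij by (auto simp: glued_arcs_def)
    qed
    moreover have "glued_verts I W = (\<Union>i\<in>I. (#) i ` W i)" by (auto simp: glued_verts_def)
    ultimately show ?thesis by simp
  qed
  ultimately show ?thesis by (simp add: connected_part_def)
qed

lemma glued_arcs_disjoint:
  assumes "H \<inter> H' = {}" "H \<inter> Id = {}" "H' \<inter> Id = {}"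
    and "\<And>i. i \<in> I \<Longrightarrow> i \<in> I' \<Longrightarrow> F i \<inter> F' i = {}"
  shows "glued_arcs n I F H \<inter> glued_arcs n I' F' H' = {}"
  using assms unfolding glued_arcs_def by fastforce

lemma connected_part_sierpinski:
  "connected_part (sierpinski n l) (pverts (sierpinski n l)) (parcs (sierpinski n l))"
proof (induction n)
  case 0
  have "parcs (sierpinski 0 l) = {}" using in_parcs_sierpinski[of _ _ 0 l] by fastforce
  moreover have "pverts (sierpinski 0 l) = {[]}" by (auto simp: pverts_sierpinski)
  ultimately show ?case by (simp add: connected_part_def sym_def)
next
  case (Suc n)
  let ?G = "sierpinski (Suc n) l" and ?H = "{..<l} \<times> {..<l} - Id"
  let ?E = "glued_arcs n {..<l} (\<lambda>_. parcs (sierpinski n l)) ?H"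
  have V: "pverts ?G = glued_verts {..<l} (\<lambda>_. pverts (sierpinski n l))"
    by (auto simp: pverts_sierpinski_Suc glued_verts_def)
  have H: "{..<l} \<times> {..<l} \<subseteq> ?H\<^sup>*"
  proof (rule subrelI)
    fix i j assume "(i, j) \<in> {..<l} \<times> {..<l}"
    then show "(i, j) \<in> ?H\<^sup>*" by (cases "i = j") blast+
  qed
  have "sym ?H" by (auto simp: sym_def)
  then have glued: "connected_part ?G (pverts ?G) ?E"
    unfolding V by (intro connected_part_glued Suc H) auto
  have E: "?E \<subseteq> parcs ?G" "pverts ?G \<times> pverts ?G \<subseteq> ?E\<^sup>*"
    using glued unfolding connected_part_def by blast+
  have "pverts ?G \<times> pverts ?G \<subseteq> (parcs ?G)\<^sup>*"
    using E(2) rtrancl_mono[OF E(1)] by (rule subset_trans)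
  moreover have "parcs ?G \<subseteq> pverts ?G \<times> pverts ?G"
    using in_parcs_sierpinski[of _ _ "Suc n" l] by (metis SigmaI subrelI)
  ultimately show ?case
    unfolding connected_part_def using sym_parcs_sierpinski by blast
qed

section \<open>Edge-disjoint spanning trees\<close>

text \<open>
For \<open>A = B\<close> up to one vertex, the double stars are \<open>l div 2\<close> edge-disjoint spanning trees of the
complete graph. By recursion each copy has \<open>l div 2\<close> edge-disjoint spanning trees, and those of the
complete graph join them up.
\<close>

lemma edge_disjoint_spanning_parts:
  "\<exists>E. (\<forall>t<l div 2. connected_part (sierpinski n l) (pverts (sierpinski n l)) (E t)) \<and>
       (\<forall>s<l div 2. \<forall>t<l div 2. s \<noteq> t \<longrightarrow> E s \<inter> E t = {})"
proof (induction n)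
  case 0
  show ?case
    by (intro exI[of _ "\<lambda>_. {}"]) (auto simp: connected_part_def pverts_sierpinski sym_def)
next
  case (Suc n)
  then obtain E where E: "\<And>t. t < l div 2 \<Longrightarrow> connected_part (sierpinski n l) (pverts (sierpinski n l)) (E t)"
    "\<And>s t. s < l div 2 \<Longrightarrow> t < l div 2 \<Longrightarrow> s \<noteq> t \<Longrightarrow> E s \<inter> E t = {}"
    by blast
  obtain H where H: "\<And>j. j < l div 2 \<Longrightarrow> H j \<subseteq> {..<l} \<times> {..<l} - Id" "\<And>j. j < l div 2 \<Longrightarrow> sym (H j)"
    "\<And>j. j < l div 2 \<Longrightarrow> {..<l} \<times> {..<l} \<subseteq> (H j)\<^sup>*" "\<And>i j. i \<noteq> j \<Longrightarrow> H i \<inter> H j = {}"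
    by (rule double_stars[of "{..<l}" "{..<2 * (l div 2)}" "l div 2"]) auto
  have V: "pverts (sierpinski (Suc n) l) = glued_verts {..<l} (\<lambda>_. pverts (sierpinski n l))"
    by (auto simp: pverts_sierpinski_Suc glued_verts_def)
  show ?case
  proof (intro exI[of _ "\<lambda>t. glued_arcs n {..<l} (\<lambda>_. E t) (H t)"] conjI allI impI)
    fix t assume t: "t < l div 2"
    show "connected_part (sierpinski (Suc n) l) (pverts (sierpinski (Suc n) l))
            (glued_arcs n {..<l} (\<lambda>_. E t) (H t))"
      unfolding V using H(1)[OF t] by (intro connected_part_glued H t E) auto
  next
    fix s t assume "s < l div 2" "t < l div 2" "s \<noteq> t"
    then show "glued_arcs n {..<l} (\<lambda>_. E s) (H s) \<inter> glued_arcs n {..<l} (\<lambda>_. E t) (H t) = {}"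
      using H(1)[of s] H(1)[of t] by (intro glued_arcs_disjoint H E) auto
  qed
qed

lemma connected_part_steiner_tree:
  assumes "connected_part (sierpinski n l) V E" "S \<subseteq> V" "V \<noteq> {}"
  shows "\<exists>T. steiner_tree (sierpinski n l) S T \<and> pverts T = V \<and> parcs T \<subseteq> E"
  using assms unfolding connected_part_def
  by (intro steiner_tree_exists pair_graph_sierpinski) auto

section \<open>Packing trees through a terminal set and prescribed corners\<close>

text \<open>
The corner \<open>replicate n c\<close> is the only vertex through which an edge can leave a copy towards its
sibling \<open>c\<close>. A statement that is fit for recursion therefore prescribes, for a set \<open>Q\<close> of corners,
the tree \<open>\<phi> c\<close> that has to contain corner \<open>c\<close>.
\<close>

definition packing ::
    "nat \<Rightarrow> nat \<Rightarrow> nat \<Rightarrow> nat list set \<Rightarrow> nat set \<Rightarrow> (nat \<Rightarrow> nat) \<Rightarrow>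
     (nat \<Rightarrow> nat list set) \<Rightarrow> (nat \<Rightarrow> (nat list \<times> nat list) set) \<Rightarrow> bool" where
  "packing n l p S Q \<phi> V E \<longleftrightarrow>
     (\<forall>t<p. connected_part (sierpinski n l) (V t) (E t) \<and> S \<subseteq> V t \<and>
        (\<forall>c\<in>Q. \<phi> c = t \<longrightarrow> replicate n c \<in> V t)) \<and>
     (\<forall>s<p. \<forall>t<p. s \<noteq> t \<longrightarrow> V s \<inter> V t = S \<and> E s \<inter> E t = {})"

text \<open>
A plan for \<open>p\<close> trees at the level of the complete graph on the copies, where \<open>A\<close> are the copies
with terminals. Tree \<open>t\<close> visits \<open>A\<close> and the empty copies \<open>N t\<close>, and crosses between copies
along \<open>H t\<close>. Each empty copy is given as a whole to at most one tree, and so the only problems left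
are inside the copies of \<open>A\<close>.
\<close>

definition routing ::
    "nat \<Rightarrow> nat \<Rightarrow> nat set \<Rightarrow> nat set \<Rightarrow> (nat \<Rightarrow> nat) \<Rightarrow>
     (nat \<Rightarrow> nat set) \<Rightarrow> (nat \<Rightarrow> (nat \<times> nat) set) \<Rightarrow> bool" where
  "routing l p A Q \<phi> N H \<longleftrightarrow>
     (\<forall>t<p. N t \<subseteq> {..<l} - A \<and> H t \<subseteq> (A \<union> N t) \<times> (A \<union> N t) - Id \<and> sym (H t) \<and>
        (A \<union> N t) \<times> (A \<union> N t) \<subseteq> (H t)\<^sup>* \<and> (\<forall>c\<in>Q - A. \<phi> c = t \<longrightarrow> c \<in> N t)) \<and>
     (\<forall>s<p. \<forall>t<p. s \<noteq> t \<longrightarrow> N s \<inter> N t = {} \<and> H s \<inter> H t = {})"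

text \<open>
The corners of copy \<open>i\<close> that the plan uses: corner \<open>c \<noteq> i\<close> for a crossing to copy \<open>c\<close>, and
corner \<open>i\<close> when it is prescribed, as corner \<open>i\<close> of copy \<open>i\<close> is corner \<open>i\<close> of the whole graph.
\<close>

definition ports :: "nat \<Rightarrow> nat set \<Rightarrow> (nat \<Rightarrow> (nat \<times> nat) set) \<Rightarrow> nat \<Rightarrow> nat set" where
  "ports p Q H i = {c. \<exists>t<p. (i, c) \<in> H t} \<union> (Q \<inter> {i})"

definition port_tree ::
    "nat \<Rightarrow> (nat \<Rightarrow> nat) \<Rightarrow> (nat \<Rightarrow> (nat \<times> nat) set) \<Rightarrow> nat \<Rightarrow> nat \<Rightarrow> nat" where
  "port_tree p \<phi> H i c = (if c = i then \<phi> i else THE t. t < p \<and> (i, c) \<in> H t)"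

lemma port_tree_eq:
  assumes R: "routing l p A Q \<phi> N H" and t: "t < p" "(i, c) \<in> H t"
  shows "port_tree p \<phi> H i c = t"
proof -
  have "c \<noteq> i" using R t unfolding routing_def by blast
  moreover have "(THE t. t < p \<and> (i, c) \<in> H t) = t"
    using R t unfolding routing_def by (intro the_equality) blast+
  ultimately show ?thesis by (simp add: port_tree_def)
qed

text \<open>
Given a plan, each copy with terminals poses the same problem one level lower, with the ports as
prescribed corners; solutions in these copies glue to a solution for the whole graph.
\<close>

lemma packing_Suc:
  assumes S: "S \<subseteq> pverts (sierpinski (Suc n) l)" and Q: "Q \<subseteq> {..<l}"
    and R: "routing l p (hd ` S) Q \<phi> N H"
    and copies: "\<And>i. i \<in> hd ` S \<Longrightarrow>
      \<exists>V E. packing n l p {u. i # u \<in> S} (ports p Q H i) (port_tree p \<phi> H i) V E"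
  shows "\<exists>V E. packing (Suc n) l p S Q \<phi> V E"
proof -
  define A where "A = hd ` S"
  note R = R[folded A_def]
  obtain V E where P: "\<And>i. i \<in> A \<Longrightarrow>
      packing n l p {u. i # u \<in> S} (ports p Q H i) (port_tree p \<phi> H i) (V i) (E i)"
    using copies[folded A_def] by metis
  have Al: "A \<subseteq> {..<l}" using S by (auto simp: A_def pverts_sierpinski_Suc)
  have SA: "\<exists>i u. x = i # u \<and> i \<in> A" if "x \<in> S" for x
    using S that by (force simp: A_def pverts_sierpinski_Suc)
  define W where "W t i = (if i \<in> A then V i t else pverts (sierpinski n l))" for t i
  define F where "F t i = (if i \<in> A then E i t else parcs (sierpinski n l))" for t i
  let ?V = "\<lambda>t. glued_verts (A \<union> N t) (W t)" and ?E = "\<lambda>t. glued_arcs n (A \<union> N t) (F t) (H t)"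
  have Rt: "N t \<subseteq> {..<l} - A" "H t \<subseteq> (A \<union> N t) \<times> (A \<union> N t) - Id" "sym (H t)"
    "(A \<union> N t) \<times> (A \<union> N t) \<subseteq> (H t)\<^sup>*" "\<And>c. c \<in> Q - A \<Longrightarrow> \<phi> c = t \<Longrightarrow> c \<in> N t" if "t < p" for t
    using R that unfolding routing_def by blast+
  have Rst: "N s \<inter> N t = {}" "H s \<inter> H t = {}" if "s < p" "t < p" "s \<noteq> t" for s t
    using R that unfolding routing_def by blast+
  have Pt: "connected_part (sierpinski n l) (V i t) (E i t)" "{u. i # u \<in> S} \<subseteq> V i t"
    "\<And>c. c \<in> ports p Q H i \<Longrightarrow> port_tree p \<phi> H i c = t \<Longrightarrow> replicate n c \<in> V i t"
    if "i \<in> A" "t < p" for i t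
    using P[OF that(1)] that(2) unfolding packing_def by blast+
  have Pst: "V i s \<inter> V i t = {u. i # u \<in> S}" "E i s \<inter> E i t = {}"
    if "i \<in> A" "s < p" "t < p" "s \<noteq> t" for i s t
    using P[OF that(1)] that(2-) unfolding packing_def by blast+
  have "packing (Suc n) l p S Q \<phi> ?V ?E"
    unfolding packing_def
  proof (intro conjI allI impI ballI)
    fix t assume t: "t < p"
    show "connected_part (sierpinski (Suc n) l) (?V t) (?E t)"
    proof (intro connected_part_glued Rt(2,3,4)[OF t])
      show "A \<union> N t \<subseteq> {..<l}" using Al Rt(1)[OF t] by blast
      show "connected_part (sierpinski n l) (W t i) (F t i)" if "i \<in> A \<union> N t" for i
        using that Pt(1) t connected_part_sierpinski \<open>A \<union> N t \<subseteq> {..<l}\<close> by (auto simp: W_def F_def)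
      show "replicate n j \<in> W t i" if ij: "(i, j) \<in> H t" for i j
      proof (cases "i \<in> A")
        case True
        moreover have "j \<in> ports p Q H i" using ij t by (auto simp: ports_def)
        ultimately show ?thesis
          using Pt(3)[OF True t] port_tree_eq[OF R t ij] by (simp add: W_def)
      next
        case False
        have "j < l" using ij Rt(2)[OF t] \<open>A \<union> N t \<subseteq> {..<l}\<close> by blast
        then show ?thesis using False by (simp add: W_def)
      qed
    qed
    show "S \<subseteq> ?V t"
    proof
      fix x assume x: "x \<in> S"
      then obtain i u where "x = i # u" "i \<in> A" using SA by blast
      then show "x \<in> ?V t" using Pt(2)[OF _ t, of i] x by (auto simp: W_def)
    qed
    show "replicate (Suc n) c \<in> ?V t" if c: "c \<in> Q" "\<phi> c = t" for c
    proof (cases "c \<in> A")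
      case True
      have "c \<in> ports p Q H c" "port_tree p \<phi> H c c = t" using c by (auto simp: ports_def port_tree_def)
      then show ?thesis using Pt(3)[OF True t] True by (simp add: W_def)
    next
      case False
      then have "c \<in> N t" using Rt(5)[OF t] c by blast
      then show ?thesis using False Q c(1) by (auto simp: W_def)
    qed
  next
    fix s t assume st: "s < p" "t < p" "s \<noteq> t"
    show "?V s \<inter> ?V t = S"
    proof
      show "?V s \<inter> ?V t \<subseteq> S"
      proof
        fix x assume x: "x \<in> ?V s \<inter> ?V t"
        then obtain i u where iu: "x = i # u" "i \<in> A \<union> N s" "u \<in> W s i" "i \<in> A \<union> N t" "u \<in> W t i"
          by (auto simp: glued_verts_def)
        then have "i \<in> A" using Rst(1)[OF st] by blast
        then show "x \<in> S" using iu Pst(1)[OF _ st, of i] by (auto simp: W_def)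
      qed
      show "S \<subseteq> ?V s \<inter> ?V t"
      proof
        fix x assume x: "x \<in> S"
        then obtain i u where "x = i # u" "i \<in> A" using SA by blast
        then show "x \<in> ?V s \<inter> ?V t" using Pt(2)[of i] st x by (auto simp: W_def)
      qed
    qed
    show "?E s \<inter> ?E t = {}"
    proof (rule glued_arcs_disjoint)
      show "H s \<inter> H t = {}" by (rule Rst(2)[OF st])
      show "H s \<inter> Id = {}" "H t \<inter> Id = {}" using Rt(2) st by blast+
      fix i assume i: "i \<in> A \<union> N s" "i \<in> A \<union> N t"
      then have "i \<in> A" using Rst(1)[OF st] by blast
      then show "F s i \<inter> F t i = {}" using Pst(2)[OF _ st] by (simp add: F_def)
    qed
  qed
  then show ?thesis by blast
qed

definition star :: "'a \<Rightarrow> 'a set \<Rightarrow> ('a \<times> 'a) set" where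
  "star h X = {h} \<times> (X - {h}) \<union> (X - {h}) \<times> {h}"

lemma star_props:
  "sym (star h X)" "h \<in> X \<Longrightarrow> X \<times> X \<subseteq> (star h X)\<^sup>*" "h \<in> X \<Longrightarrow> star h X \<subseteq> X \<times> X - Id"
proof -
  show s: "sym (star h X)" by (auto simp: star_def sym_def)
  show "X \<times> X \<subseteq> (star h X)\<^sup>*" if "h \<in> X"
  proof clarify
    fix x y assume "x \<in> X" "y \<in> X"
    then have "(x, h) \<in> (star h X)\<^sup>*" "(h, y) \<in> (star h X)\<^sup>*"
      by (cases "x = h"; cases "y = h"; force simp: star_def)+
    then show "(x, y) \<in> (star h X)\<^sup>*" by (rule rtrancl_trans)
  qed
  show "star h X \<subseteq> X \<times> X - Id" if "h \<in> X" using that by (auto simp: star_def)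
qed

text \<open>
The induction invariant, where \<open>k\<close> is the number of terminals. A single terminal allows any
prescription. Otherwise the first inequality says that there are at most \<open>l - \<lceil>k / 2\<rceil>\<close> trees even
if a tree is counted once for each corner that it has to contain; this is the bound that already
holds in a complete graph. The second one reserves a spare port for the step to the copies, where a
copy \<open>i\<close> has one port for each tree and possibly corner \<open>i\<close> in addition. For even \<open>k\<close> it
fails at the top, where \<open>p = l - \<lceil>k / 2\<rceil>\<close>, but there no corner is prescribed.
\<close>

definition feasible :: "nat \<Rightarrow> nat \<Rightarrow> nat \<Rightarrow> nat set \<Rightarrow> (nat \<Rightarrow> nat) \<Rightarrow> bool" where
  "feasible l p k Q \<phi> \<longleftrightarrow> k = 1 \<or>
     card Q + card {t. t < p \<and> t \<notin> \<phi> ` Q} + (k + 1) div 2 \<le> l \<and>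
     (Q = {} \<or> p + 1 + k div 2 \<le> l)"

text \<open>
If a single copy holds all terminals, every tree leaves it only towards its prescribed
corners, and the copy inherits the problem unchanged.
\<close>

lemma routing_one_copy:
  assumes i: "i < l" and Q: "Q \<subseteq> {..<l}" "\<phi> ` Q \<subseteq> {..<p}" and f: "feasible l p k Q \<phi>"
  shows "\<exists>N H. routing l p {i} Q \<phi> N H \<and> feasible l p k (ports p Q H i) (port_tree p \<phi> H i)"
proof -
  define N where "N t = {c \<in> Q - {i}. \<phi> c = t}" for t
  define H where "H t = star i (insert i (N t))" for t
  have R: "routing l p {i} Q \<phi> N H"
    unfolding routing_def
  proof (intro conjI allI impI ballI)
    fix t assume "t < p"
    show "N t \<subseteq> {..<l} - {i}" using Q by (auto simp: N_def)
    show "H t \<subseteq> ({i} \<union> N t) \<times> ({i} \<union> N t) - Id" "sym (H t)"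
      "({i} \<union> N t) \<times> ({i} \<union> N t) \<subseteq> (H t)\<^sup>*"
      unfolding H_def using star_props[of i "insert i (N t)"] by auto
    show "c \<in> N t" if "c \<in> Q - {i}" "\<phi> c = t" for c using that by (simp add: N_def)
  next
    fix s t :: nat assume "s \<noteq> t"
    then show "N s \<inter> N t = {}" "H s \<inter> H t = {}" by (auto simp: N_def H_def star_def)
  qed
  have ports: "ports p Q H i = Q"
    using Q(2) by (auto simp: ports_def H_def star_def N_def)
  have "port_tree p \<phi> H i c = \<phi> c" if c: "c \<in> Q" for c
  proof (cases "c = i")
    case False
    then have "(i, c) \<in> H (\<phi> c)" using c by (auto simp: H_def star_def N_def)
    then show ?thesis using port_tree_eq[OF R] Q(2) c by blast
  qed (simp add: port_tree_def)
  then have "port_tree p \<phi> H i ` Q = \<phi> ` Q" by (intro image_cong) auto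
  then show ?thesis using R f ports by (intro exI[of _ N] exI[of _ H]) (simp add: feasible_def)
qed

text \<open>
A tree that owns an empty copy is a star with that copy as its hub. Empty copies with a prescribed
corner go to the tree that has to contain it, the other ones to trees without such a copy, as far as
they last. The \<open>r\<close> trees that remain become edge-disjoint double stars on \<open>A\<close> with centres among the
copies that hold a single terminal; these impose no limit on their ports. Every other copy of \<open>A\<close>
is a leaf of every star and double star, and so has a single port for each tree besides its own
corner. It also holds fewer terminals than the whole graph, which yields the invariant again.
\<close>

lemma routing_many_copies:
  assumes A: "A \<subseteq> {..<l}" "2 \<le> card A" and k: "\<And>i. i \<in> A \<Longrightarrow> 1 \<le> k i"
    and Q: "Q \<subseteq> {..<l}" "\<phi> ` Q \<subseteq> {..<p}" and f: "feasible l p (\<Sum>i\<in>A. k i) Q \<phi>"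
  shows "\<exists>N H. routing l p A Q \<phi> N H \<and>
    (\<forall>i\<in>A. feasible l p (k i) (ports p Q H i) (port_tree p \<phi> H i))"
proof -
  define K where "K = (\<Sum>i\<in>A. k i)"
  define Z where "Z = {..<l} - A"
  define D where "D = \<phi> ` (Q \<inter> Z)"
  define U where "U = {..<p} - D"
  define X where "X = Z - Q"
  define Y where "Y = {i \<in> A. k i = 1}"
  define r where "r = card U - card X"
  have fin: "finite A" "finite Q" "finite Z" "finite U" "finite X"
    using A(1) Q(1) finite_subset by (auto simp: Z_def U_def X_def)
  have QAZ: "Q = (Q \<inter> A) \<union> (Q \<inter> Z)" using Q(1) by (auto simp: Z_def)
  have AK: "card A \<le> K"
    unfolding K_def using sum_bounded_below[of A 1 k] k by simp
  then have K2: "K \<noteq> 1" using A(2) by simp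
  have f1: "card Q + card {t. t < p \<and> t \<notin> \<phi> ` Q} + (K + 1) div 2 \<le> l"
    and f2: "Q = {} \<or> p + 1 + K div 2 \<le> l"
    using f K2 by (auto simp: feasible_def K_def)
  \<comment> \<open>\<open>Z\<close> are the empty copies, \<open>D\<close> the trees with a prescribed corner in one of them, \<open>U\<close> the other
    trees and \<open>X\<close> the empty copies that these may take; \<open>r\<close> trees of \<open>U\<close> get none. Feasibility
    makes \<open>r\<close> at most half the number of copies with a single terminal.\<close>
  have cZ: "card Z + card A = l"
    using A(1) card_mono[OF _ A(1)] fin(1) by (simp add: Z_def card_Diff_subset)
  have "card (Q \<inter> Z) + card X = card Z"
    using card_Int_Diff[OF fin(3), of Q] by (simp add: X_def inf_commute)
  moreover have "card (Q \<inter> A) + card (Q \<inter> Z) = card Q"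
  proof -
    have "Q \<inter> Z = Q - A" using Q(1) by (auto simp: Z_def)
    then show ?thesis using card_Int_Diff[OF fin(2), of A] by simp
  qed
  moreover have "card U \<le> card {t. t < p \<and> t \<notin> \<phi> ` Q} + card (Q \<inter> A)"
  proof -
    have "U \<subseteq> {t. t < p \<and> t \<notin> \<phi> ` Q} \<union> \<phi> ` (Q \<inter> A)" using QAZ by (auto simp: U_def D_def)
    then have "card U \<le> card ({t. t < p \<and> t \<notin> \<phi> ` Q} \<union> \<phi> ` (Q \<inter> A))"
      using fin by (intro card_mono) auto
    also have "\<dots> \<le> card {t. t < p \<and> t \<notin> \<phi> ` Q} + card (\<phi> ` (Q \<inter> A))" by (rule card_Un_le)
    finally show ?thesis using card_image_le[of "Q \<inter> A" \<phi>] fin by simp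
  qed
  ultimately have rK: "r = 0 \<or> 2 * r + K \<le> 2 * card A"
    using f1 cZ unfolding r_def by linarith
  have "2 * card A = (\<Sum>i\<in>A. 2)" by simp
  also have "\<dots> \<le> (\<Sum>i\<in>A. k i + (if k i = 1 then 1 else 0))"
  proof (rule sum_mono)
    fix i assume "i \<in> A"
    then show "2 \<le> k i + (if k i = 1 then 1 else 0)" using k[of i] by auto
  qed
  also have "\<dots> = K + card Y"
    using fin(1) by (simp add: sum.distrib K_def Y_def sum.If_cases Int_def)
  finally have "2 * r \<le> card Y" using rK by auto
  then obtain B where B: "B \<subseteq> Y" "card B = 2 * r" using obtain_subset_with_card_n by metis
  obtain G where G: "\<And>j. j < r \<Longrightarrow> G j \<subseteq> A \<times> A - Id" "\<And>j. j < r \<Longrightarrow> sym (G j)"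
    "\<And>j. j < r \<Longrightarrow> A \<times> A \<subseteq> (G j)\<^sup>*"
    "\<And>i j. i \<noteq> j \<Longrightarrow> G i \<inter> G j = {}"
    "\<And>j x. j < r \<Longrightarrow> x \<in> A - B \<Longrightarrow> \<exists>y. G j `` {x} = {y}"
    using double_stars[of A B r] fin(1) B by (auto simp: Y_def)
  \<comment> \<open>\<open>U1\<close> are the trees of \<open>U\<close> that get a hub; those of \<open>U - U1\<close> become double stars.\<close>
  obtain U1 where U1: "U1 \<subseteq> U" "card U1 = min (card U) (card X)"
    using obtain_subset_with_card_n[of "min (card U) (card X)" U] by auto
  have finU1: "finite U1" using U1(1) fin(4) finite_subset by blast
  obtain g where g: "inj_on g U1" "g ` U1 \<subseteq> X"
    using card_le_inj[of U1 X] finU1 fin U1(2) by auto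
  have "card (U - U1) = r"
    using U1 finU1 by (simp add: card_Diff_subset r_def)
  then obtain idx where idx: "bij_betw idx (U - U1) {..<r}"
    using fin(4) by (metis card_lessThan finite_Diff finite_lessThan finite_same_card_bij)
  \<comment> \<open>A tree of \<open>D\<close> takes all empty copies with a corner prescribed to it, one of them as its hub.\<close>
  define N where "N t = (if t \<in> D then {c \<in> Q \<inter> Z. \<phi> c = t} else if t \<in> U1 then {g t} else {})" for t
  define hub where "hub t = (if t \<in> D then (SOME c. c \<in> Q \<inter> Z \<and> \<phi> c = t) else g t)" for t
  define H where "H t = (if t \<in> U - U1 then G (idx t) else star (hub t) (A \<union> N t))" for t
  have UD: "t \<in> U - U1 \<or> t \<in> D \<or> t \<in> U1" if "t < p" for t using that by (auto simp: U_def)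
  have NZ: "N t \<subseteq> Z" for t using g by (auto simp: N_def X_def)
  have hubN: "hub t \<in> N t" if "t < p" "t \<notin> U - U1" for t
  proof (cases "t \<in> D")
    case True
    then have "\<exists>c. c \<in> Q \<inter> Z \<and> \<phi> c = t" by (auto simp: D_def)
    from someI_ex[OF this] show ?thesis using True by (simp add: N_def hub_def)
  next
    case False
    then show ?thesis using UD[OF that(1)] that(2) by (auto simp: N_def hub_def)
  qed
  have Nin: "N t = {}" if "t \<in> U - U1" for t using that by (simp add: N_def U_def)
  have idxr: "idx t < r" if "t \<in> U - U1" for t using that idx by (auto simp: bij_betw_def)
  have Ndisj: "N s \<inter> N t = {}" if "s \<noteq> t" for s t
    using that g by (auto simp: N_def X_def inj_on_def)
  have R: "routing l p A Q \<phi> N H"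
    unfolding routing_def
  proof (intro conjI allI impI ballI)
    fix t assume t: "t < p"
    show "N t \<subseteq> {..<l} - A" using NZ by (auto simp: Z_def)
    show "c \<in> N t" if "c \<in> Q - A" "\<phi> c = t" for c
      using that Q(1) by (auto simp: N_def D_def Z_def)
    show "H t \<subseteq> (A \<union> N t) \<times> (A \<union> N t) - Id" "sym (H t)" "(A \<union> N t) \<times> (A \<union> N t) \<subseteq> (H t)\<^sup>*"
      using G(1-3)[OF idxr] Nin star_props[of "hub t" "A \<union> N t"] hubN[OF t] unfolding H_def by auto
  next
    fix s t assume st: "s < p" "t < p" "s \<noteq> t"
    show "N s \<inter> N t = {}" using Ndisj st by blast
    have ZA: "Z \<inter> A = {}" by (auto simp: Z_def)
    have inner: "H t \<subseteq> A \<times> A" if "t \<in> U - U1" for t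
      using that G(1)[OF idxr[OF that]] by (auto simp: H_def)
    have outer: "x \<in> N t \<or> y \<in> N t" if "t < p" "t \<notin> U - U1" "(x, y) \<in> H t" for t x y
      using that hubN[of t] by (auto simp: H_def star_def)
    have hsub: "x \<in> A \<union> N t \<and> y \<in> A \<union> N t" if "t < p" "t \<notin> U - U1" "(x, y) \<in> H t" for t x y
      using that hubN[of t] by (auto simp: H_def star_def)
    have False if xy: "(x, y) \<in> H s" "(x, y) \<in> H t" for x y
    proof (cases "s \<in> U - U1"; cases "t \<in> U - U1")
      assume s: "s \<in> U - U1" and t: "t \<in> U - U1"
      then have "idx s \<noteq> idx t" using idx st(3) by (auto simp: bij_betw_def inj_on_def)
      then have "G (idx s) \<inter> G (idx t) = {}" by (rule G(4))
      moreover have "H s = G (idx s)" "H t = G (idx t)" using s t by (simp_all only: H_def if_True)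
      ultimately show False using xy by blast
    next
      assume s: "s \<in> U - U1" and t: "t \<notin> U - U1"
      then show False using inner[OF s] outer[OF st(2) t xy(2)] NZ[of t] ZA xy(1) by blast
    next
      assume s: "s \<notin> U - U1" and t: "t \<in> U - U1"
      then show False using inner[OF t] outer[OF st(1) s xy(1)] NZ[of s] ZA xy(2) by blast
    next
      assume s: "s \<notin> U - U1" and t: "t \<notin> U - U1"
      then show False
        using outer[OF st(1) s xy(1)] hsub[OF st(2) t xy(2)] NZ[of s] ZA Ndisj[OF st(3)] by blast
    qed
    then show "H s \<inter> H t = {}" by auto
  qed
  have "feasible l p (k i) (ports p Q H i) (port_tree p \<phi> H i)" if i: "i \<in> A" for i
  proof (cases "k i = 1")
    case True
    then show ?thesis by (simp add: feasible_def)
  next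
    case False
    then have iB: "i \<in> A - B" using i B(1) by (auto simp: Y_def)
    have "\<exists>c. H t `` {i} = {c}" if t: "t < p" for t
    proof (cases "t \<in> U - U1")
      case True
      then show ?thesis using G(5)[OF idxr[OF True] iB] by (simp add: H_def)
    next
      case False
      then have "hub t \<notin> A" using hubN[OF t False] NZ[of t] by (auto simp: Z_def)
      then have "H t `` {i} = {hub t}" using False i by (auto simp: H_def star_def)
      then show ?thesis by blast
    qed
    \<comment> \<open>\<open>e t\<close> is the only port of tree \<open>t\<close> at copy \<open>i\<close>, apart from a prescribed corner \<open>i\<close>.\<close>
    then obtain e where e: "\<And>t. t < p \<Longrightarrow> H t `` {i} = {e t}" by metis
    have P: "ports p Q H i = e ` {..<p} \<union> (Q \<inter> {i})"
      using e unfolding ports_def by (auto simp: set_eq_iff Image_singleton)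
    have cP: "card (ports p Q H i) \<le> p + card (Q \<inter> {i})"
    proof -
      have "card (ports p Q H i) \<le> card (e ` {..<p}) + card (Q \<inter> {i})"
        unfolding P by (rule card_Un_le)
      then show ?thesis using card_image_le[of "{..<p}" e] by simp
    qed
    have "t \<in> port_tree p \<phi> H i ` ports p Q H i" if t: "t < p" for t
    proof -
      have "(i, e t) \<in> H t" using e[OF t] by blast
      then have "port_tree p \<phi> H i (e t) = t" using port_tree_eq[OF R t] by blast
      then show ?thesis using P t by force
    qed
    then have miss: "{t. t < p \<and> t \<notin> port_tree p \<phi> H i ` ports p Q H i} = {}" by blast
    have kK: "k i < K"
    proof -
      have "card (A - {i}) \<ge> 1" using A(2) fin(1) i by simp
      moreover have "card (A - {i}) \<le> (\<Sum>j\<in>A - {i}. k j)"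
        using sum_bounded_below[of "A - {i}" 1 k] k by simp
      moreover have "K = k i + (\<Sum>j\<in>A - {i}. k j)"
        unfolding K_def using fin(1) i by (rule sum.remove)
      ultimately show ?thesis by simp
    qed
    have "card (ports p Q H i) + (k i + 1) div 2 \<le> l \<and> p + 1 + k i div 2 \<le> l"
    proof (cases "Q = {}")
      case True
      then have "p + (K + 1) div 2 \<le> l" using f1 by simp
      moreover have "card (ports p Q H i) \<le> p" using cP True by simp
      moreover have "(k i + 1) div 2 \<le> (K + 1) div 2" "1 + k i div 2 \<le> (K + 1) div 2"
        using kK by presburger+
      ultimately show ?thesis by linarith
    next
      case False
      then have "p + 1 + K div 2 \<le> l" using f2 by simp
      moreover have "card (Q \<inter> {i}) \<le> 1" using card_mono[of "{i}" "Q \<inter> {i}"] by simp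
      moreover have "(k i + 1) div 2 \<le> K div 2" "k i div 2 \<le> K div 2" using kK by (auto intro: div_le_mono)
      ultimately show ?thesis using cP by linarith
    qed
    then show ?thesis unfolding feasible_def miss by simp
  qed
  then show ?thesis using R by blast
qed

text \<open>
The induction starts at the graph with one vertex, where all corners coincide with the only
terminal. The complete graph is the first step of the induction.
\<close>

lemma packing_exists:
  assumes "S \<subseteq> pverts (sierpinski n l)" "S \<noteq> {}" "Q \<subseteq> {..<l}" "\<phi> ` Q \<subseteq> {..<p}"
    and "feasible l p (card S) Q \<phi>"
  shows "\<exists>V E. packing n l p S Q \<phi> V E"
  using assms
proof (induction n arbitrary: S Q \<phi>)
  case 0
  then have "S = {[]}" by (auto simp: pverts_sierpinski)
  then show ?case
    by (intro exI[of _ "\<lambda>_. {[]}"] exI[of _ "\<lambda>_. {}"])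
      (auto simp: packing_def connected_part_def pverts_sierpinski sym_def)
next
  case (Suc n)
  define A where "A = hd ` S"
  define k where "k i = card {u. i # u \<in> S}" for i
  have finS: "finite S" using Suc.prems(1) finite_pverts_sierpinski finite_subset by blast
  then have finA: "finite A" by (simp add: A_def)
  have A: "A \<subseteq> {..<l}" using Suc.prems(1) by (auto simp: A_def pverts_sierpinski_Suc)
  have fibre: "{u. i # u \<in> S} \<subseteq> pverts (sierpinski n l)" "{u. i # u \<in> S} \<noteq> {}" if i: "i \<in> A" for i
  proof -
    show "{u. i # u \<in> S} \<subseteq> pverts (sierpinski n l)" using Suc.prems(1) by auto
    obtain x where x: "x \<in> S" "i = hd x" using i by (auto simp: A_def)
    then have "x = i # tl x" using Suc.prems(1) by (auto simp: pverts_sierpinski_Suc)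
    then show "{u. i # u \<in> S} \<noteq> {}" using x(1) by (metis empty_Collect_eq)
  qed
  have finf: "finite {u. i # u \<in> S}" if "i \<in> A" for i
    using fibre(1)[OF that] finite_pverts_sierpinski finite_subset by blast
  have kpos: "1 \<le> k i" if "i \<in> A" for i
    using fibre(2)[OF that] finf[OF that] by (simp add: k_def Suc_le_eq card_gt_0_iff)
  have cS: "card S = (\<Sum>i\<in>A. k i)"
  proof -
    have "S = (\<Union>i\<in>A. (#) i ` {u. i # u \<in> S})"
      using Suc.prems(1) by (force simp: A_def pverts_sierpinski_Suc)
    then have "card S = card (\<Union>i\<in>A. (#) i ` {u. i # u \<in> S})" by simp
    also have "\<dots> = (\<Sum>i\<in>A. card ((#) i ` {u. i # u \<in> S}))"
      using finA finf by (intro card_UN_disjoint) auto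
    finally show ?thesis by (simp add: k_def card_image)
  qed
  have "\<exists>N H. routing l p A Q \<phi> N H \<and>
    (\<forall>i\<in>A. feasible l p (k i) (ports p Q H i) (port_tree p \<phi> H i))"
  proof (cases "2 \<le> card A")
    case True
    show ?thesis
      using routing_many_copies[OF A True kpos Suc.prems(3,4)] Suc.prems(5) cS by auto
  next
    case False
    moreover have "card A \<noteq> 0" using finA Suc.prems(2) by (simp add: A_def)
    ultimately obtain i where i: "A = {i}" using card_1_singletonE[of A] by (metis One_nat_def Suc_1 less_2_cases not_le)
    then show ?thesis
      using routing_one_copy[of i l Q \<phi> p "k i"] A Suc.prems(3-5) cS by auto
  qed
  then obtain N H where R: "routing l p A Q \<phi> N H"
    and f: "\<And>i. i \<in> A \<Longrightarrow> feasible l p (k i) (ports p Q H i) (port_tree p \<phi> H i)" by blast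
  show ?case
  proof (rule packing_Suc[OF Suc.prems(1,3)])
    show "routing l p (hd ` S) Q \<phi> N H" using R by (simp add: A_def)
    fix i assume "i \<in> hd ` S"
    then have i: "i \<in> A" by (simp add: A_def)
    show "\<exists>V E. packing n l p {u. i # u \<in> S} (ports p Q H i) (port_tree p \<phi> H i) V E"
    proof (rule Suc.IH[OF fibre(1)[OF i] fibre(2)[OF i]])
      have Hl: "H t \<subseteq> {..<l} \<times> {..<l}" if "t < p" for t
        using R A that unfolding routing_def by blast
      then show "ports p Q H i \<subseteq> {..<l}"
        using Suc.prems(3) by (auto simp: ports_def)
      show "port_tree p \<phi> H i ` ports p Q H i \<subseteq> {..<p}"
      proof clarify
        fix c assume c: "c \<in> ports p Q H i"
        show "port_tree p \<phi> H i c < p"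
        proof (cases "\<exists>t<p. (i, c) \<in> H t")
          case True
          then show ?thesis using port_tree_eq[OF R] by auto
        next
          case False
          then have "c = i" "i \<in> Q" using c by (auto simp: ports_def)
          then show ?thesis using Suc.prems(4) by (auto simp: port_tree_def)
        qed
      qed
      show "feasible l p (card {u. i # u \<in> S}) (ports p Q H i) (port_tree p \<phi> H i)"
        using f[OF i] by (simp add: k_def)
    qed
  qed
qed

section \<open>The generalized connectivities\<close>

lemma internally_disjoint_steiner_exists:
  assumes S: "S \<subseteq> pverts (sierpinski n l)" "S \<noteq> {}" and p: "p + (card S + 1) div 2 \<le> l"
  shows "\<exists>T. internally_disjoint_steiner (sierpinski n l) S p T"
proof -
  have "\<exists>V E. packing n l p S {} (\<lambda>_. 0) V E"
    using p by (intro packing_exists S) (auto simp: feasible_def)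
  then obtain V E where VE: "packing n l p S {} (\<lambda>_. 0) V E" by blast
  have "\<exists>T. steiner_tree (sierpinski n l) S T \<and> pverts T = V t \<and> parcs T \<subseteq> E t" if "t < p" for t
    using VE S(2) that by (intro connected_part_steiner_tree) (auto simp: packing_def)
  then obtain T where T: "\<And>t. t < p \<Longrightarrow>
      steiner_tree (sierpinski n l) S (T t) \<and> pverts (T t) = V t \<and> parcs (T t) \<subseteq> E t" by metis
  have "internally_disjoint_steiner (sierpinski n l) S p T"
    unfolding internally_disjoint_steiner_def
  proof (intro conjI allI impI)
    fix s t assume "s < p" "t < p" "s \<noteq> t"
    then have "V s \<inter> V t = S" "E s \<inter> E t = {}" "pverts (T s) = V s" "pverts (T t) = V t"
      "parcs (T s) \<subseteq> E s" "parcs (T t) \<subseteq> E t"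
      using VE T by (auto simp: packing_def)
    then show "parcs (T s) \<inter> parcs (T t) = {}" "pverts (T s) \<inter> pverts (T t) = S" by blast+
  qed (use T in blast)
  then show ?thesis by blast
qed

lemma edge_disjoint_steiner_exists:
  assumes S: "S \<subseteq> pverts (sierpinski n l)" "S \<noteq> {}"
  shows "\<exists>T. edge_disjoint_steiner (sierpinski n l) S (l div 2) T"
proof -
  obtain E where
    "\<forall>t<l div 2. connected_part (sierpinski n l) (pverts (sierpinski n l)) (E t)"
    "\<forall>s<l div 2. \<forall>t<l div 2. s \<noteq> t \<longrightarrow> E s \<inter> E t = {}"
    using edge_disjoint_spanning_parts[of l n] by (elim exE conjE)
  note E = this(1)[rule_format] this(2)[rule_format]
  have "\<exists>T. steiner_tree (sierpinski n l) S T \<and> parcs T \<subseteq> E t" if "t < l div 2" for t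
    using connected_part_steiner_tree[OF E(1)[OF that] S(1)] S by blast
  then obtain T where T: "\<And>t. t < l div 2 \<Longrightarrow>
      steiner_tree (sierpinski n l) S (T t) \<and> parcs (T t) \<subseteq> E t" by metis
  then have "edge_disjoint_steiner (sierpinski n l) S (l div 2) T"
    unfolding edge_disjoint_steiner_def
  proof (intro conjI allI impI)
    fix s t assume "s < l div 2" "t < l div 2" "s \<noteq> t"
    then have "E s \<inter> E t = {}" "parcs (T s) \<subseteq> E s" "parcs (T t) \<subseteq> E t" using T E(2) by simp_all
    then show "parcs (T s) \<inter> parcs (T t) = {}" by blast
  qed (use T in simp)
  then show ?thesis by blast
qed

lemma le_kappa_set:
  assumes "pair_graph G" "2 \<le> card S" "internally_disjoint_steiner G S p T"
  shows "p \<le> kappa_set G S"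
  unfolding kappa_set_def
proof (rule Max_ge)
  show "p \<in> {p. \<exists>T. internally_disjoint_steiner G S p T}" using assms(3) by auto
qed (rule finite_internally_disjoint_steiner[OF assms(1,2)])

lemma le_lambda_set:
  assumes "pair_graph G" "2 \<le> card S" "edge_disjoint_steiner G S p T"
  shows "p \<le> lambda_set G S"
  unfolding lambda_set_def
proof (rule Max_ge)
  show "p \<in> {p. \<exists>T. edge_disjoint_steiner G S p T}" using assms(3) by auto
qed (rule finite_edge_disjoint_steiner[OF assms(1,2)])

lemma kappa_set_le_lambda_set:
  assumes "pair_graph G" "2 \<le> card S"
  shows "kappa_set G S \<le> lambda_set G S"
  unfolding kappa_set_def lambda_set_def
proof (rule Max_mono)
  show "{p. \<exists>T. internally_disjoint_steiner G S p T} \<subseteq> {p. \<exists>T. edge_disjoint_steiner G S p T}"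
  proof clarify
    fix p T assume "internally_disjoint_steiner G S p T"
    then have "edge_disjoint_steiner G S p T"
      by (simp add: internally_disjoint_steiner_def edge_disjoint_steiner_def)
    then show "\<exists>T. edge_disjoint_steiner G S p T" by blast
  qed
  have "internally_disjoint_steiner G S 0 T" for T by (simp add: internally_disjoint_steiner_def)
  then show "{p. \<exists>T. internally_disjoint_steiner G S p T} \<noteq> {}" by blast
  show "finite {p. \<exists>T. edge_disjoint_steiner G S p T}"
    by (rule finite_edge_disjoint_steiner[OF assms])
qed

lemma lambda_set_le:
  assumes "pair_graph G" "2 \<le> card S" "\<And>p T. edge_disjoint_steiner G S p T \<Longrightarrow> p \<le> b"
  shows "lambda_set G S \<le> b"
proof -
  have "edge_disjoint_steiner G S 0 T" for T by (simp add: edge_disjoint_steiner_def)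
  then have "{p. \<exists>T. edge_disjoint_steiner G S p T} \<noteq> {}" by auto
  then show ?thesis
    unfolding lambda_set_def
    using finite_edge_disjoint_steiner[OF assms(1,2)] assms(3) by (subst Max_le_iff) auto
qed

lemma Min_over_subsets_le:
  fixes f :: "'a set \<Rightarrow> nat"
  assumes "finite V" "S \<subseteq> V" "card S = k" "f S \<le> b"
  shows "Min {f S | S. S \<subseteq> V \<and> card S = k} \<le> b"
proof -
  have eq: "{f S | S. S \<subseteq> V \<and> card S = k} = f ` {S. S \<subseteq> V \<and> card S = k}" by auto
  have "Min (f ` {S. S \<subseteq> V \<and> card S = k}) \<le> f S" using assms(1-3) by (intro Min_le) auto
  then show ?thesis unfolding eq using assms(4) by (rule le_trans)
qed

lemma le_Min_over_subsets:
  fixes f :: "'a set \<Rightarrow> nat"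
  assumes "finite V" "k \<le> card V" "\<And>S. S \<subseteq> V \<Longrightarrow> card S = k \<Longrightarrow> b \<le> f S"
  shows "b \<le> Min {f S | S. S \<subseteq> V \<and> card S = k}"
proof -
  have eq: "{f S | S. S \<subseteq> V \<and> card S = k} = f ` {S. S \<subseteq> V \<and> card S = k}" by auto
  obtain S where "S \<subseteq> V" "card S = k" using obtain_subset_with_card_n[OF assms(2)] by metis
  then show ?thesis unfolding eq using assms(1,3) by (intro Min.boundedI) auto
qed

text \<open>
The connectivities are minima, so every terminal set bounds them from above, and the bound improves
with the number of copies that the set meets.
\<close>

lemma connectivities_le:
  assumes S: "S \<subseteq> pverts (sierpinski (Suc n) l)" and A: "2 \<le> card (hd ` S)"
  shows "gen_connectivity (card S) (sierpinski (Suc n) l) \<le> l - (card (hd ` S) + 1) div 2"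
    and "gen_edge_connectivity (card S) (sierpinski (Suc n) l) \<le> l - (card (hd ` S) + 1) div 2"
proof -
  have finS: "finite S" using S finite_pverts_sierpinski finite_subset by blast
  have S2: "2 \<le> card S" using A card_image_le[OF finS, of hd] by simp
  have "lambda_set (sierpinski (Suc n) l) S \<le> l - (card (hd ` S) + 1) div 2"
  proof (rule lambda_set_le[OF pair_graph_sierpinski S2])
    fix p T assume "edge_disjoint_steiner (sierpinski (Suc n) l) S p T"
    then have "2 * p + card (hd ` S) \<le> 2 * l" by (rule edge_disjoint_steiner_sierpinski_le[OF _ S A])
    then show "p \<le> l - (card (hd ` S) + 1) div 2" by linarith
  qed
  moreover from this have "kappa_set (sierpinski (Suc n) l) S \<le> l - (card (hd ` S) + 1) div 2"
    using kappa_set_le_lambda_set[OF pair_graph_sierpinski S2] le_trans by blast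
  ultimately show "gen_connectivity (card S) (sierpinski (Suc n) l) \<le> l - (card (hd ` S) + 1) div 2"
    and "gen_edge_connectivity (card S) (sierpinski (Suc n) l) \<le> l - (card (hd ` S) + 1) div 2"
    unfolding gen_connectivity_def gen_edge_connectivity_def
    using S by (intro Min_over_subsets_le finite_pverts_sierpinski refl; simp)+
qed

lemma le_connectivities:
  assumes k: "2 \<le> k" "k \<le> l ^ n" and p: "p + (k + 1) div 2 \<le> l"
  shows "p \<le> gen_connectivity k (sierpinski n l)" and "p \<le> gen_edge_connectivity k (sierpinski n l)"
proof -
  have kV: "k \<le> card (pverts (sierpinski n l))" using k(2) by (simp add: card_pverts_sierpinski)
  have kappa: "p \<le> kappa_set (sierpinski n l) S"
    if S: "S \<subseteq> pverts (sierpinski n l)" "card S = k" for S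
  proof -
    have "S \<noteq> {}" using S(2) k(1) by auto
    moreover have "p + (card S + 1) div 2 \<le> l" using p S(2) by simp
    ultimately obtain T where "internally_disjoint_steiner (sierpinski n l) S p T"
      using internally_disjoint_steiner_exists[OF S(1)] by auto
    moreover have "2 \<le> card S" using S(2) k(1) by simp
    ultimately show ?thesis by (intro le_kappa_set pair_graph_sierpinski)
  qed
  have lambda: "p \<le> lambda_set (sierpinski n l) S"
    if S: "S \<subseteq> pverts (sierpinski n l)" "card S = k" for S
  proof -
    have "2 \<le> card S" using S(2) k(1) by simp
    from kappa_set_le_lambda_set[OF pair_graph_sierpinski this] show ?thesis
      by (rule le_trans[OF kappa[OF S]])
  qed
  show "p \<le> gen_connectivity k (sierpinski n l)"
    unfolding gen_connectivity_def by (rule le_Min_over_subsets[OF finite_pverts_sierpinski kV kappa])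
  show "p \<le> gen_edge_connectivity k (sierpinski n l)"
    unfolding gen_edge_connectivity_def
    by (rule le_Min_over_subsets[OF finite_pverts_sierpinski kV lambda])
qed

lemma half_le_edge_connectivity:
  assumes k: "2 \<le> k" "k \<le> l ^ n"
  shows "l div 2 \<le> gen_edge_connectivity k (sierpinski n l)"
proof -
  have lambda: "l div 2 \<le> lambda_set (sierpinski n l) S"
    if S: "S \<subseteq> pverts (sierpinski n l)" "card S = k" for S
  proof -
    have "S \<noteq> {}" using S(2) k(1) by auto
    then obtain T where "edge_disjoint_steiner (sierpinski n l) S (l div 2) T"
      using edge_disjoint_steiner_exists[OF S(1)] by auto
    moreover have "2 \<le> card S" using S(2) k(1) by simp
    ultimately show ?thesis by (intro le_lambda_set pair_graph_sierpinski)
  qed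
  have "k \<le> card (pverts (sierpinski n l))" using k(2) by (simp add: card_pverts_sierpinski)
  then show ?thesis
    unfolding gen_edge_connectivity_def
    by (rule le_Min_over_subsets[OF finite_pverts_sierpinski _ lambda])
qed

text \<open>
The corners of the graph lie in pairwise different copies, so they serve as terminals for the upper
bounds.
\<close>

lemma corners_meet_copies:
  fixes n m l :: nat
  assumes "m \<le> l"
  defines "C \<equiv> replicate (Suc n) ` {..<m}"
  shows "C \<subseteq> pverts (sierpinski (Suc n) l)" "card C = m" "hd ` C = {..<m}"
proof -
  show "C \<subseteq> pverts (sierpinski (Suc n) l)" using assms by (auto simp: C_def)
  show "card C = m" unfolding C_def by (subst card_image) (auto simp: inj_on_def)
  show "hd ` C = {..<m}" by (force simp: C_def image_image)
qed

theorem theorem1p5: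
  fixes n l :: nat
  assumes "n \<ge> 1" and "l \<ge> 3"
  shows "(\<forall>k. 3 \<le> k \<and> k \<le> l \<longrightarrow>
            int (gen_connectivity k (sierpinski n l)) = int l - \<lceil>real k / 2\<rceil> \<and>
            int (gen_edge_connectivity k (sierpinski n l)) = int l - \<lceil>real k / 2\<rceil>) \<and>
         (\<forall>k. l + 1 \<le> k \<and> k \<le> l ^ n \<longrightarrow>
            int (gen_connectivity k (sierpinski n l)) \<le> \<lfloor>real l / 2\<rfloor> \<and>
            int (gen_edge_connectivity k (sierpinski n l)) = \<lfloor>real l / 2\<rfloor>)"
proof -
  obtain m where n: "n = Suc m" using assms(1) by (cases n) auto
  have ceil: "\<lceil>real k / 2\<rceil> = int ((k + 1) div 2)" for k
    by (rule ceiling_unique) (auto simp: field_simps; linarith)+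
  have floor: "\<lfloor>real k / 2\<rfloor> = int (k div 2)" for k
    using floor_divide_of_nat_eq[of k 2] by simp
  have i: "gen_connectivity k (sierpinski n l) = l - (k + 1) div 2"
      "gen_edge_connectivity k (sierpinski n l) = l - (k + 1) div 2" if k: "3 \<le> k" "k \<le> l" for k
  proof -
    have "k \<le> l ^ n" using k assms n by (metis le_trans self_le_power less_le_trans zero_less_numeral One_nat_def Suc_leI zero_less_Suc)
    moreover have "l - (k + 1) div 2 + (k + 1) div 2 \<le> l" using k by simp
    moreover note corners_meet_copies[OF k(2), of m]
    ultimately show "gen_connectivity k (sierpinski n l) = l - (k + 1) div 2"
        "gen_edge_connectivity k (sierpinski n l) = l - (k + 1) div 2"
      using le_connectivities[of k l n "l - (k + 1) div 2"] k(1)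
        connectivities_le[of "replicate (Suc m) ` {..<k}" m l]
      unfolding n by (auto intro: antisym)
  qed
  have ii: "gen_connectivity k (sierpinski n l) \<le> l div 2"
      "gen_edge_connectivity k (sierpinski n l) = l div 2" if k: "l + 1 \<le> k" "k \<le> l ^ n" for k
  proof -
    note C = corners_meet_copies[OF order_refl, of m l]
    \<comment> \<open>Any set of \<open>k\<close> terminals that contains all corners meets every copy.\<close>
    have "card (replicate (Suc m) ` {..<l}) \<le> k" using C(2) k(1) by simp
    moreover have "k \<le> card (pverts (sierpinski n l))" using k(2) by (simp add: card_pverts_sierpinski)
    moreover have "replicate (Suc m) ` {..<l} \<subseteq> pverts (sierpinski n l)" using C(1) n by simp
    ultimately obtain S where S: "replicate (Suc m) ` {..<l} \<subseteq> S"
        "S \<subseteq> pverts (sierpinski n l)" "card S = k"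
      using finite_pverts_sierpinski by (rule exists_subset_between[THEN exE]) auto
    have "hd ` S \<subseteq> {..<l}" using S(2) n by (auto simp: pverts_sierpinski_Suc)
    moreover have "{..<l} \<subseteq> hd ` S" using C(3) S(1) by blast
    ultimately have "card (hd ` S) = l" by (metis card_lessThan subset_antisym)
    moreover have "l - (l + 1) div 2 = l div 2" by simp
    ultimately have "gen_connectivity k (sierpinski n l) \<le> l div 2"
        "gen_edge_connectivity k (sierpinski n l) \<le> l div 2"
      using connectivities_le[of S m l] S(2,3) n assms(2) by auto
    then show "gen_connectivity k (sierpinski n l) \<le> l div 2"
      "gen_edge_connectivity k (sierpinski n l) = l div 2"
      using half_le_edge_connectivity[of k l n] k assms(2) by auto
  qed
  show ?thesis
    using i ii by (auto simp: ceil floor of_nat_diff)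
qed

end
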